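(* Let $K$ be a Corson compact space whose weight $w(K)$ satisfies $w(K)\ge\mathfrak c$. Then there exists a nontrivial twisted sum of $c_0$ and $C(K)$. In particular, assuming the Continuum Hypothesis ($\mathfrak c=\omega_1$), for every nonmetrizable Corson compact space $K$ there exists a nontrivial twisted sum of $c_0$ and $C(K)$.
   Context: For a compact Hausdorff space $K$, $C(K)$ is the Banach space of continuous real-valued functions on $K$ with the supremum norm; $c_0$ is the Banach space of real sequences converging to zero with the sup norm. For Banach spaces $Y,X$, a twisted sum of $Y$ and $X$ is a short exact sequence $0\to Y\to Z\to X\to 0$ where $Z$ is a Banach space and the maps are bounded linear operators; it is trivial if it splits, i.e., the image of $Y\to Z$ is complemented in $Z$. $\mathfrak c$ denotes the cardinality of the continuum. For an index set $I$, $\Sigma(I)=\{x\in\mathbb R^I:\{i\in I: x_i\neq 0\}\text{ is countable}\}$. A compact Hausdorff space $K$ is a Corson compactum if there exist an index set $I$ and a continuous injection $\varphi:K\to\mathbb R^I$ with $\varphi[K]\subset\Sigma(I)$. *)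

theory Defs
  imports "HOL-Analysis.Analysis"
begin

definition norm_on :: "'v::real_vector set \<Rightarrow> ('v \<Rightarrow> real) \<Rightarrow> bool" where
  "norm_on S N \<longleftrightarrow> subspace S \<and>
     (\<forall>x\<in>S. N x \<ge> 0 \<and> (N x = 0 \<longleftrightarrow> x = 0)) \<and>
     (\<forall>x\<in>S. \<forall>c::real. N (c *\<^sub>R x) = \<bar>c\<bar> * N x) \<and>
     (\<forall>x\<in>S. \<forall>y\<in>S. N (x + y) \<le> N x + N y)"

definition banach_on :: "'v::real_vector set \<Rightarrow> ('v \<Rightarrow> real) \<Rightarrow> bool" where
  "banach_on S N \<longleftrightarrow> norm_on S N \<and>
     (\<forall>u::nat \<Rightarrow> 'v. (\<forall>n. u n \<in> S) \<and>
        (\<forall>e>0. \<exists>M. \<forall>m\<ge>M. \<forall>n\<ge>M. N (u m - u n) < e)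
        \<longrightarrow> (\<exists>z\<in>S. (\<lambda>n. N (u n - z)) \<longlonglongrightarrow> 0))"

definition bounded_linear_on ::
  "'v::real_vector set \<Rightarrow> ('v \<Rightarrow> real) \<Rightarrow> 'w::real_vector set \<Rightarrow> ('w \<Rightarrow> real) \<Rightarrow> ('v \<Rightarrow> 'w) \<Rightarrow> bool" where
  "bounded_linear_on S N T M f \<longleftrightarrow>
     (\<forall>x\<in>S. f x \<in> T) \<and>
     (\<forall>x\<in>S. \<forall>y\<in>S. f (x + y) = f x + f y) \<and>
     (\<forall>x\<in>S. \<forall>c::real. f (c *\<^sub>R x) = c *\<^sub>R f x) \<and>
     (\<exists>C. \<forall>x\<in>S. M (f x) \<le> C * N x)"

definition closed_in_norm :: "'v::real_vector set \<Rightarrow> ('v \<Rightarrow> real) \<Rightarrow> 'v set \<Rightarrow> bool" where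
  "closed_in_norm S N W \<longleftrightarrow> (\<forall>u z. (\<forall>n. u n \<in> W) \<and> z \<in> S \<and> (\<lambda>n. N (u n - z)) \<longlonglongrightarrow> 0 \<longrightarrow> z \<in> W)"

definition complemented_in :: "'v::real_vector set \<Rightarrow> ('v \<Rightarrow> real) \<Rightarrow> 'v set \<Rightarrow> bool" where
  "complemented_in S N V \<longleftrightarrow>
     (\<exists>W. W \<subseteq> S \<and> subspace W \<and> closed_in_norm S N W \<and> V \<inter> W = {0} \<and>
          (\<forall>z\<in>S. \<exists>v\<in>V. \<exists>w\<in>W. z = v + w))"

definition twisted_sum ::
  "'y::real_vector set \<Rightarrow> ('y \<Rightarrow> real) \<Rightarrow> 'x::real_vector set \<Rightarrow> ('x \<Rightarrow> real) \<Rightarrow>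
   'z::real_vector set \<Rightarrow> ('z \<Rightarrow> real) \<Rightarrow> ('y \<Rightarrow> 'z) \<Rightarrow> ('z \<Rightarrow> 'x) \<Rightarrow> bool" where
  "twisted_sum Y NY X NX Z NZ j q \<longleftrightarrow>
     banach_on Y NY \<and> banach_on X NX \<and> banach_on Z NZ \<and>
     bounded_linear_on Y NY Z NZ j \<and> bounded_linear_on Z NZ X NX q \<and>
     inj_on j Y \<and> j ` Y = {z\<in>Z. q z = 0} \<and> q ` Z = X"

definition trivial_twisted_sum ::
  "'z::real_vector set \<Rightarrow> ('z \<Rightarrow> real) \<Rightarrow> 'y::real_vector set \<Rightarrow> ('y \<Rightarrow> 'z) \<Rightarrow> bool" where
  "trivial_twisted_sum Z NZ Y j \<longleftrightarrow> complemented_in Z NZ (j ` Y)"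

text \<open>c_0, realised inside \<ell>_\<infinity> = bounded functions on nat, with the sup norm.\<close>
definition c0 :: "(nat \<Rightarrow>\<^sub>C real) set" where
  "c0 = {x. (\<lambda>n. apply_bcontfun x n) \<longlonglongrightarrow> 0}"

definition nontrivial_twisted_sum_c0_CK :: "'a::topological_space itself \<Rightarrow> bool" where
  "nontrivial_twisted_sum_c0_CK _ \<longleftrightarrow>
     (\<exists>(Z :: ((nat \<Rightarrow>\<^sub>C real) \<times> ('a \<Rightarrow>\<^sub>C real)) set) NZ j q.
        twisted_sum c0 norm (UNIV :: ('a \<Rightarrow>\<^sub>C real) set) norm Z NZ j q \<and>
        \<not> trivial_twisted_sum Z NZ c0 j)"

definition corson_via :: "('a::topological_space \<Rightarrow> ('i \<Rightarrow> real)) \<Rightarrow> bool" where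
  "corson_via \<phi> \<longleftrightarrow> continuous_on UNIV \<phi> \<and> inj \<phi> \<and> (\<forall>x. countable {i. \<phi> x i \<noteq> 0})"

definition weight_ge_continuum :: "'a::topological_space itself \<Rightarrow> bool" where
  "weight_ge_continuum _ \<longleftrightarrow>
     (\<forall>B :: 'a set set. topological_basis B \<longrightarrow> (\<exists>f :: real \<Rightarrow> 'a set. inj f \<and> range f \<subseteq> B))"

definition CH :: bool where
  "CH \<longleftrightarrow> (\<forall>S :: real set. uncountable S \<longrightarrow> (\<exists>f. bij_betw f S (UNIV :: real set)))"

end

theory Submission
  imports Defs
begin

text \<open>Pulling \<open>\<ell>\<^sub>\<infinity> \<rightarrow> \<ell>\<^sub>\<infinity>/c\<^sub>0\<close> back along an operator \<open>C(K) \<rightarrow> \<ell>\<^sub>\<infinity>/c\<^sub>0\<close> gives a twisted sum of \<open>c\<^sub>0\<close>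
  and \<open>C(K)\<close> that splits only if the operator lifts to a bounded operator into \<open>\<ell>\<^sub>\<infinity>\<close>. The operator
  used is \<open>f \<mapsto> [\<Sum>\<alpha>. (f (a \<alpha>) - f (b \<alpha>)) 1\<^bsub>A \<alpha>\<^esub>]\<close>, where the \<open>A \<alpha>\<close> are almost disjoint and the points
  \<open>a \<alpha>\<close>, \<open>b \<alpha>\<close> of \<open>K\<close> differ in pairwise disjoint sets of coordinates, so that the increments of \<open>f\<close>
  tend to zero. Such pairs arise from \<open>a\<close> by erasing all coordinates outside a suitable small set.

  The coordinates of a lifting are measures of uniformly bounded mass, and mass at least one half on
  disjointly supported bump functions can be charged only boundedly often. With uncountably many
  disjoint open sets this is contradictory for any almost disjoint family. Otherwise there are
  infinitely many disjoint open sets each carrying at least continuum many coordinates, and the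
  \<open>A \<alpha>\<close> are chosen by diagonalizing against all sequences of sets of integers.\<close>

unbundle cardinal_syntax

section \<open>Banach spaces of bounded continuous functions and their closed subspaces\<close>

instance bcontfun :: (topological_space, complete_space) complete_space
proof
  fix f :: "nat \<Rightarrow> ('a, 'b) bcontfun"
  assume "Cauchy f"
  then obtain g where "uniform_limit UNIV f g sequentially"
    using uniformly_convergent_eq_cauchy[of "\<lambda>_. True" f]
    unfolding Cauchy_def uniform_limit_sequentially_iff
    by (metis dist_fun_lt_imp_dist_val_lt)
  from uniform_limit_bcontfunE[OF this sequentially_bot]
  obtain l where "g = apply_bcontfun l" "f \<longlonglongrightarrow> l" by metis
  then show "convergent f"
    by (intro convergentI)
qed

instance bcontfun :: (topological_space, banach) banach ..

text \<open>All three spaces of the twisted sum are closed subspaces of complete types, so this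
  settles their Banach requirements.\<close>

lemma banach_on_closed_subspace:
  fixes S :: "'v::banach set"
  assumes "subspace S" "closed S"
  shows "banach_on S norm"
  unfolding banach_on_def norm_on_def
proof (intro conjI allI impI ballI)
  fix u :: "nat \<Rightarrow> 'v"
  assume u: "(\<forall>n. u n \<in> S) \<and> (\<forall>e>0. \<exists>M. \<forall>m\<ge>M. \<forall>n\<ge>M. norm (u m - u n) < e)"
  then have "Cauchy u"
    by (simp add: Cauchy_def dist_norm)
  then obtain z where z: "u \<longlonglongrightarrow> z"
    using Cauchy_convergent convergent_def by blast
  then have "z \<in> S"
    using u assms(2) closed_sequentially[OF _ _ z] by blast
  moreover have "(\<lambda>n. norm (u n - z)) \<longlonglongrightarrow> 0"
    by (intro tendsto_norm_zero LIM_zero z)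
  ultimately show "\<exists>z\<in>S. (\<lambda>n. norm (u n - z)) \<longlonglongrightarrow> 0"
    by blast
qed (use assms in \<open>auto simp: norm_triangle_ineq\<close>)

section \<open>Closed graph theorem\<close>

text \<open>Once Baire gives that every \<open>u\<close> is approximated within half its norm by some \<open>v\<close>
  with \<open>L v\<close> under control, iterating on the remainder writes \<open>u\<close> as a series along which
  \<open>L\<close> is absolutely summable.\<close>
lemma closed_graph_bounded:
  fixes L :: "'x::banach \<Rightarrow> 'y::banach"
  assumes L: "linear L"
    and graph: "\<And>u x y. u \<longlonglongrightarrow> x \<Longrightarrow> (\<lambda>n. L (u n)) \<longlonglongrightarrow> y \<Longrightarrow> L x = y"
  shows "\<exists>C. \<forall>x. norm (L x) \<le> C * norm x"
proof -
  interpret L: linear L by (rule L)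
  \<comment> \<open>These sublevel sets cover the space, so by Baire the closure of one of them
    contains a ball.\<close>
  define E where "E n = {x. norm (L x) \<le> real n}" for n :: nat
  have cov: "(\<Union>n. closure (E n)) = UNIV"
  proof -
    have "x \<in> closure (E (nat \<lceil>norm (L x)\<rceil>))" for x
      by (rule subsetD[OF closure_subset]) (auto simp: E_def intro: real_nat_ceiling_ge)
    then show ?thesis by blast
  qed
  have "\<exists>n. interior (closure (E n)) \<noteq> {}"
  proof (rule ccontr)
    assume "\<nexists>n. interior (closure (E n)) \<noteq> {}"
    then have "euclidean interior_of \<Union>(range (\<lambda>n. closure (E n))) = {}"
      by (intro Baire_category_alt)
        (auto simp: completely_metrizable_space_euclidean)
    then show False
      using cov by simp
  qed
  then obtain n x0 r where r: "r > 0" and ball: "ball x0 r \<subseteq> closure (E n)"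
    by (metis ex_in_conv interior_subset mem_interior)
  \<comment> \<open>Half differences stay in the convex symmetric set \<open>E n\<close>; this moves
    the ball from \<open>x0\<close> to the origin.\<close>
  have E_mid: "(1/2) *\<^sub>R (x - y) \<in> E n" if "x \<in> E n" "y \<in> E n" for x y
  proof -
    have "norm (L ((1/2) *\<^sub>R (x - y))) = norm (L x - L y) / 2"
      by (simp add: L.scale L.diff)
    also have "\<dots> \<le> real n"
      using norm_triangle_ineq4[of "L x" "L y"] that by (simp add: E_def)
    finally show ?thesis by (simp add: E_def)
  qed
  have near: "\<exists>v. norm (L v) \<le> real n \<and> norm (u - v) < d" if "norm u < r" "d > 0" for u d
  proof -
    have "x0 + u \<in> closure (E n)" "x0 - u \<in> closure (E n)"
      using ball that by (auto simp: subset_eq dist_norm)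
    then obtain x y where xy: "x \<in> E n" "norm (x - (x0 + u)) < d" "y \<in> E n" "norm (y - (x0 - u)) < d"
      using \<open>d > 0\<close> unfolding closure_approachable dist_norm by metis
    have "u - (1/2) *\<^sub>R (x - y) = (1/2) *\<^sub>R ((y - (x0 - u)) - (x - (x0 + u)))"
      by (simp add: algebra_simps flip: scaleR_left_distrib)
    then have "norm (u - (1/2) *\<^sub>R (x - y)) = norm ((y - (x0 - u)) - (x - (x0 + u))) / 2"
      by simp
    also have "\<dots> < d"
      using norm_triangle_ineq4[of "y - (x0 - u)" "x - (x0 + u)"] xy by linarith
    finally show ?thesis
      using E_mid[OF xy(1,3)] by (auto simp: E_def)
  qed
  \<comment> \<open>Scaling \<open>u\<close> to norm \<open>r/2\<close> and approximating within
    \<open>r/4\<close> leaves relative error one half; scaling back turns the bound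
    \<open>real n\<close> into \<open>M * norm u\<close>.\<close>
  define M where "M = 2 * real n / r"
  have M: "M \<ge> 0" using r by (simp add: M_def)
  have step: "\<exists>v. norm (L v) \<le> M * norm u \<and> norm (u - v) \<le> norm u / 2" for u
  proof (cases "u = 0")
    case False
    define c where "c = r / (2 * norm u)"
    have c: "c > 0" using False r by (simp add: c_def)
    have "norm (c *\<^sub>R u) < r"
      using False r by (simp add: c_def)
    from near[OF this, of "r/4"] r obtain v
      where v: "norm (L v) \<le> real n" "norm (c *\<^sub>R u - v) < r/4" by auto
    have "norm (L ((1/c) *\<^sub>R v)) = norm (L v) / c"
      using c by (simp add: L.scale)
    also have "\<dots> \<le> real n / c"
      using v c by (intro divide_right_mono) auto
    also have "\<dots> = M * norm u"
      using False r by (simp add: M_def c_def field_simps)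
    finally have 1: "norm (L ((1/c) *\<^sub>R v)) \<le> M * norm u" .
    have "u - (1/c) *\<^sub>R v = (1/c) *\<^sub>R (c *\<^sub>R u - v)"
      using c by (simp add: algebra_simps)
    then have "norm (u - (1/c) *\<^sub>R v) = norm (c *\<^sub>R u - v) / c"
      using c by simp
    also have "\<dots> \<le> (r/4) / c"
      using v c by (intro divide_right_mono) auto
    also have "\<dots> = norm u / 2"
      using False r by (simp add: c_def field_simps)
    finally show ?thesis using 1 by blast
  qed (auto intro!: exI[of _ 0] simp: L.zero)
  then obtain g where g: "\<And>u. norm (L (g u)) \<le> M * norm u" "\<And>u. norm (u - g u) \<le> norm u / 2"
    by metis
  have "norm (L x) \<le> 2 * M * norm x" for x
  proof -
    define w where "w k = ((\<lambda>u. u - g u) ^^ k) x" for k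
    have w0: "w 0 = x" and wS: "w (Suc k) = w k - g (w k)" for k
      by (auto simp: w_def)
    have wn: "norm (w k) \<le> norm x * (1/2)^k" for k
    proof (induction k)
      case (Suc k)
      have "norm (w (Suc k)) \<le> norm (w k) / 2"
        using g(2) by (simp add: wS)
      with Suc show ?case by simp
    qed (simp add: w0)
    have "(\<lambda>k. norm x * (1/2::real)^k) \<longlonglongrightarrow> norm x * 0"
      by (intro tendsto_mult tendsto_const LIMSEQ_power_zero) auto
    then have wlim: "w \<longlonglongrightarrow> 0"
      using wn by (intro Lim_null_comparison[of w]) auto
    have part: "(\<Sum>k<m. g (w k)) = x - w m" for m
      by (induction m) (auto simp: w0 wS)
    have gn: "norm (L (g (w k))) \<le> M * norm x * (1/2)^k" for k
      using g(1)[of "w k"] mult_left_mono[OF wn[of k] M] by (simp add: mult.assoc)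
    have geo: "(\<lambda>k. M * norm x * (1/2::real)^k) sums (M * norm x * 2)"
      using sums_mult[OF geometric_sums[of "1/2::real"], of "M * norm x"] by simp
    have summ: "summable (\<lambda>k. norm (L (g (w k))))"
      by (rule summable_comparison_test[OF _ sums_summable[OF geo]]) (use gn in auto)
    have "(\<lambda>m. \<Sum>k<m. L (g (w k))) \<longlonglongrightarrow> (\<Sum>k. L (g (w k)))"
      using summable_LIMSEQ[OF summable_norm_cancel[OF summ]] .
    \<comment> \<open>The partial sums tend to \<open>x\<close> and their images converge, so the
      closed graph identifies the limit as \<open>L x\<close>.\<close>
    then have "(\<lambda>m. L (x - w m)) \<longlonglongrightarrow> (\<Sum>k. L (g (w k)))"
      by (simp add: part flip: L.sum)
    moreover have "(\<lambda>m. x - w m) \<longlonglongrightarrow> x"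
      using tendsto_diff[OF tendsto_const wlim] by auto
    ultimately have "L x = (\<Sum>k. L (g (w k)))"
      by (rule graph[rotated])
    also have "norm \<dots> \<le> (\<Sum>k. norm (L (g (w k))))"
      by (rule summable_norm[OF summ])
    also have "\<dots> \<le> (\<Sum>k. M * norm x * (1/2)^k)"
      by (rule suminf_le[OF gn summ sums_summable[OF geo]])
    also have "\<dots> = 2 * M * norm x"
      using sums_unique[OF geo] by simp
    finally show ?thesis .
  qed
  then show ?thesis
    by (intro exI[of _ "2 * M"]) simp
qed

section \<open>Sets smaller than the continuum and almost disjoint families\<close>

text \<open>Base three with digits 0 and 1 avoids ambiguous expansions: at the first difference
  \<open>m\<close> the whole later tail is at most half of \<open>(1/3)^m\<close>.\<close>

lemma card_nat_set_le_real: "|UNIV :: nat set set| \<le>o |UNIV :: real set|"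
proof -
  define h :: "nat set \<Rightarrow> nat \<Rightarrow> real" where "h X n = (if n \<in> X then (1/3)^n else 0)" for X n
  have geo: "(\<lambda>n. (1/3::real)^n) sums (3/2)"
    using geometric_sums[of "1/3::real"] by simp
  have summ: "summable (h X)" for X
    by (rule summable_comparison_test'[OF sums_summable[OF geo], of 0]) (auto simp: h_def)
  have less: "suminf (h X) < suminf (h Y)"
    if m: "m \<in> Y" "m \<notin> X" and eq: "\<And>n. n < m \<Longrightarrow> n \<in> X \<longleftrightarrow> n \<in> Y" for X Y m
  proof -
    have tail: "(\<lambda>n. (1/3::real)^(n + Suc m)) sums ((1/3)^Suc m * (3/2))"
      using sums_mult[OF geo, of "(1/3)^Suc m"] by (simp add: power_add mult.commute)
    have "suminf (h X) = (\<Sum>n. h X (n + Suc m)) + sum (h X) {..<Suc m}"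
      by (rule suminf_split_initial_segment[OF summ])
    also have "(\<Sum>n. h X (n + Suc m)) \<le> (\<Sum>n. (1/3)^(n + Suc m))"
      by (rule suminf_le[OF _ summable_ignore_initial_segment[OF summ] sums_summable[OF tail]])
        (auto simp: h_def)
    also have "\<dots> = (1/3)^Suc m * (3/2)"
      using sums_unique[OF tail] by simp
    also have "sum (h X) {..<Suc m} = sum (h Y) {..<m}"
      using m eq by (auto simp: h_def intro!: sum.cong)
    also have "(1/3)^Suc m * (3/2) + sum (h Y) {..<m} < sum (h Y) {..<Suc m}"
      using m by (simp add: h_def)
    also have "\<dots> \<le> suminf (h Y)"
      by (rule sum_le_suminf[OF summ]) (auto simp: h_def)
    finally show ?thesis by simp
  qed
  have "inj (\<lambda>X. suminf (h X))"
  proof (rule injI, rule ccontr)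
    fix X Y assume eq: "suminf (h X) = suminf (h Y)" and "X \<noteq> Y"
    then have "\<exists>n. (n \<in> X) \<noteq> (n \<in> Y)" by blast
    then obtain m where m: "(m \<in> X) \<noteq> (m \<in> Y)" and min: "\<And>n. n < m \<Longrightarrow> (n \<in> X) = (n \<in> Y)"
      unfolding exists_least_iff[of "\<lambda>n. (n \<in> X) \<noteq> (n \<in> Y)"] by blast
    from m consider "m \<in> Y" "m \<notin> X" | "m \<in> X" "m \<notin> Y" by blast
    then show False
      using less[of m Y X] less[of m X Y] min eq by cases auto
  qed
  then show ?thesis
    by (rule card_of_ordLeqI) simp
qed

text \<open>A real is determined by its Dedekind cut, transported to the naturals by an enumeration
  of the rationals.\<close>

lemma card_real_le_nat_set: "|UNIV :: real set| \<le>o |UNIV :: nat set set|"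
proof (rule card_of_ordLeqI)
  have "x = y" if "{n. of_rat (from_nat n) < x} = {n. of_rat (from_nat n) < y}" for x y :: real
  proof (rule ccontr)
    have *: False if "u < v" "{n. of_rat (from_nat n) < u} = {n. of_rat (from_nat n) < v}" for u v :: real
    proof -
      obtain q where q: "u < of_rat q" "of_rat q < v"
        using of_rat_dense[OF \<open>u < v\<close>] by blast
      then have "to_nat q \<in> {n. of_rat (from_nat n) < u}"
        unfolding that(2) by simp
      with q show False by simp
    qed
    assume "x \<noteq> y"
    then show False
      using * that by (metis linorder_less_linear)
  qed
  then show "inj (\<lambda>x::real. {n. of_rat (from_nat n) < x})"
    by (rule injI)
qed simp

lemma card_nat_set_seq_le_real: "|UNIV :: (nat \<Rightarrow> nat set) set| \<le>o |UNIV :: real set|"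
proof -
  have "inj (\<lambda>B :: nat \<Rightarrow> nat set. {m. snd (prod_decode m) \<in> B (fst (prod_decode m))})"
  proof (rule injI, intro ext set_eqI)
    fix B C :: "nat \<Rightarrow> nat set" and n k
    assume "{m. snd (prod_decode m) \<in> B (fst (prod_decode m))} = {m. snd (prod_decode m) \<in> C (fst (prod_decode m))}"
    then show "k \<in> B n \<longleftrightarrow> k \<in> C n"
      by (auto simp: set_eq_iff dest: spec[of _ "prod_encode (n, k)"])
  qed
  then have "|UNIV :: (nat \<Rightarrow> nat set) set| \<le>o |UNIV :: nat set set|"
    by (rule card_of_ordLeqI) simp
  then show ?thesis
    using card_nat_set_le_real ordLeq_transitive by blast
qed

lemma card_real_seq_le_real: "|UNIV :: (nat \<Rightarrow> real) set| \<le>o |UNIV :: real set|"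
proof -
  obtain f :: "real \<Rightarrow> nat set" where "inj f"
    using card_real_le_nat_set unfolding card_of_ordLeq[symmetric] by blast
  then have "inj (\<lambda>g::nat \<Rightarrow> real. f \<circ> g)"
    by (rule fun.inj_map)
  then have "|UNIV :: (nat \<Rightarrow> real) set| \<le>o |UNIV :: (nat \<Rightarrow> nat set) set|"
    by (rule card_of_ordLeqI) simp
  then show ?thesis
    using card_nat_set_seq_le_real ordLeq_transitive by blast
qed

section \<open>Cardinal arithmetic below the continuum\<close>

abbreviation below_continuum :: "'b set \<Rightarrow> bool" where
  "below_continuum S \<equiv> |S| <o |UNIV :: real set|"

lemma not_below_continuum_iff: "\<not> below_continuum S \<longleftrightarrow> |UNIV :: real set| \<le>o |S|"
  using not_ordLess_iff_ordLeq by (auto intro: card_of_Well_order)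

lemma below_continuum_mono: "|S| \<le>o |T| \<Longrightarrow> below_continuum T \<Longrightarrow> below_continuum S"
  by (rule ordLeq_ordLess_trans)

lemma countable_below_continuum:
  assumes "countable S"
  shows "below_continuum S"
proof (rule ccontr)
  assume "\<not> below_continuum S"
  then obtain f :: "real \<Rightarrow> 'a" where "inj f" "range f \<subseteq> S"
    unfolding not_below_continuum_iff card_of_ordLeq[symmetric] by blast
  then have "countable (UNIV :: real set)"
    using assms countable_image_inj_on countable_subset by metis
  then show False
    using uncountable_UNIV_real by blast
qed

text \<open>Koenig's argument: an injection of \<open>nat \<Rightarrow> real\<close> into the union is defeated by a sequence
  whose \<open>n\<close>-th entry avoids the \<open>n\<close>-th entries of all sequences mapped into \<open>S n\<close>.\<close>
lemma below_continuum_UN_nat: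
  fixes S :: "nat \<Rightarrow> 'b set"
  assumes "\<And>n. below_continuum (S n)"
  shows "below_continuum (\<Union>n. S n)"
proof (rule ccontr)
  assume "\<not> below_continuum (\<Union>n. S n)"
  then have "|UNIV :: (nat \<Rightarrow> real) set| \<le>o |\<Union>n. S n|"
    using card_real_seq_le_real ordLeq_transitive unfolding not_below_continuum_iff by blast
  then obtain g :: "(nat \<Rightarrow> real) \<Rightarrow> 'b" where g: "inj g" "range g \<subseteq> (\<Union>n. S n)"
    unfolding card_of_ordLeq[symmetric] by blast
  have "\<exists>r. \<forall>h. g h \<in> S n \<longrightarrow> h n \<noteq> r" for n
  proof (rule ccontr)
    assume "\<nexists>r. \<forall>h. g h \<in> S n \<longrightarrow> h n \<noteq> r"
    then obtain H where H: "\<And>r. g (H r) \<in> S n" "\<And>r. H r n = r"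
      by metis
    then have "inj (\<lambda>r. g (H r))"
      using g(1) by (metis injI injD)
    then have "|UNIV :: real set| \<le>o |S n|"
      by (rule card_of_ordLeqI) (simp add: H)
    then show False
      using assms not_below_continuum_iff by blast
  qed
  then obtain r where r: "\<And>n h. g h \<in> S n \<Longrightarrow> h n \<noteq> r n"
    by metis
  obtain n where "g r \<in> S n"
    using g(2) by blast
  with r show False by blast
qed

lemma below_continuum_Un:
  assumes "below_continuum A" "below_continuum B"
  shows "below_continuum (A \<union> B)"
proof -
  have "A \<union> B = (\<Union>n::nat. if n = 0 then A else B)" by (auto split: if_splits)
  also have "below_continuum (\<Union>n::nat. if n = 0 then A else B)"
    using assms by (intro below_continuum_UN_nat) auto
  finally show ?thesis .
qed

text \<open>An infinite bound absorbs countable unions and lists, so \<open>M\<close> stands in for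
  \<open>S\<close> in closing-off arguments: the naturals if \<open>S\<close> is countable, an
  injective image of \<open>S\<close> otherwise. Placing it inside the reals fixes its type.\<close>

lemma below_continuum_infinite_bound:
  assumes "below_continuum S"
  obtains M :: "real set" where "infinite M" "|S| \<le>o |M|" "below_continuum M"
proof (cases "countable S")
  case True
  then have "|S| \<le>o |UNIV :: nat set|"
    by (metis card_of_ordLeqI UNIV_I countableE)
  also have "|UNIV :: nat set| \<le>o |\<nat> :: real set|"
    by (rule card_of_ordLeqI[of of_nat]) (auto simp: inj_on_def)
  finally have "|S| \<le>o |\<nat> :: real set|" .
  moreover have "infinite (\<nat> :: real set)"
    unfolding Nats_def by (rule range_inj_infinite) (simp add: inj_on_def)
  moreover have "below_continuum (\<nat> :: real set)"
    by (rule countable_below_continuum) (simp add: Nats_def)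
  ultimately show ?thesis
    using that by blast
next
  case False
  obtain f :: "'a \<Rightarrow> real" where f: "inj_on f S"
    using ordLess_imp_ordLeq[OF assms] unfolding card_of_ordLeq[symmetric] by blast
  then have "infinite (f ` S)"
    using False by (simp add: finite_image_iff) (metis countable_finite)
  moreover have "|S| \<le>o |f ` S|"
    by (rule card_of_ordLeqI[OF f]) simp
  ultimately show ?thesis
    using that below_continuum_mono[OF card_of_image assms] by blast
qed

lemma card_of_countable_ordLeq_infinite:
  assumes "countable A" "infinite M"
  shows "|A| \<le>o |M|"
proof -
  have "|A| \<le>o |UNIV :: nat set|"
    using assms(1) by (metis card_of_ordLeqI UNIV_I countableE)
  also have "|UNIV :: nat set| \<le>o |M|"
    using assms(2) infinite_iff_card_of_nat by blast
  finally show ?thesis .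
qed

text \<open>Countability of the pieces makes regularity of the continuum unnecessary: the union is
  no larger than an infinite bound of \<open>S\<close>.\<close>

lemma below_continuum_UN_countable:
  assumes "below_continuum S" "\<And>s. s \<in> S \<Longrightarrow> countable (F s)"
  shows "below_continuum (\<Union>s\<in>S. F s)"
proof -
  obtain M :: "real set" where M: "infinite M" "|S| \<le>o |M|" "below_continuum M"
    using below_continuum_infinite_bound[OF assms(1)] .
  have "|\<Union>s\<in>S. F s| \<le>o |M|"
    using M assms(2) by (intro card_of_UNION_ordLeq_infinite) (auto intro: card_of_countable_ordLeq_infinite)
  then show ?thesis
    using M(3) by (rule below_continuum_mono)
qed

lemma card_of_lists_ordLeq_infinite:
  assumes M: "infinite M" and A: "|A| \<le>o |M|"
  shows "|lists A| \<le>o |M|"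
proof -
  have len: "|{xs \<in> lists A. length xs = n}| \<le>o |M|" for n
  proof (induction n)
    case 0
    have "{xs \<in> lists A. length xs = 0} \<subseteq> {[]}" by auto
    then have "countable {xs \<in> lists A. length xs = 0}"
      by (rule countable_subset) simp
    then show ?case
      using M by (rule card_of_countable_ordLeq_infinite)
  next
    case (Suc n)
    have sub: "{xs \<in> lists A. length xs = Suc n}
        \<subseteq> (\<lambda>(a, xs). a # xs) ` (A \<times> {xs \<in> lists A. length xs = n})"
      by (auto simp: length_Suc_conv image_iff)
    have "|{xs \<in> lists A. length xs = Suc n}|
        \<le>o |(\<lambda>(a, xs). a # xs) ` (A \<times> {xs \<in> lists A. length xs = n})|"
      by (rule card_of_mono1[OF sub])
    also have "|(\<lambda>(a, xs). a # xs) ` (A \<times> {xs \<in> lists A. length xs = n})|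
        \<le>o |A \<times> {xs \<in> lists A. length xs = n}|"
      by (rule card_of_image)
    also have "|A \<times> {xs \<in> lists A. length xs = n}| \<le>o |M|"
      by (rule card_of_Sigma_ordLeq_infinite[OF M A]) (use Suc in blast)
    finally show ?case .
  qed
  have "lists A = (\<Union>n. {xs \<in> lists A. length xs = n})" by auto
  moreover have "|\<Union>n. {xs \<in> lists A. length xs = n}| \<le>o |M|"
    using M len by (intro card_of_UNION_ordLeq_infinite) (auto intro: card_of_countable_ordLeq_infinite)
  ultimately show ?thesis by metis
qed

section \<open>Branches of the binary tree as an almost disjoint family\<close>

text \<open>The branch of the binary tree through \<open>X\<close>, as a set of codes of its nodes.\<close>
definition branch :: "nat set \<Rightarrow> nat set" where
  "branch X = range (\<lambda>n. prod_encode (n, set_encode (X \<inter> {..<n})))"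

lemma infinite_branch: "infinite (branch X)"
  unfolding branch_def by (rule range_inj_infinite) (auto simp: inj_def)

text \<open>A node records its level and the part of the set below that level, so branches share no
  node above a level \<open>m\<close> at which the sets differ.\<close>

lemma finite_branch_Int:
  assumes "X \<noteq> Y"
  shows "finite (branch X \<inter> branch Y)"
proof -
  obtain m where m: "(m \<in> X) \<noteq> (m \<in> Y)" using assms by blast
  have "n \<le> m" if "set_encode (X \<inter> {..<n}) = set_encode (Y \<inter> {..<n})" for n
  proof (rule ccontr)
    assume "\<not> n \<le> m"
    moreover have "X \<inter> {..<n} = Y \<inter> {..<n}"
      using that set_encode_eq[of "X \<inter> {..<n}" "Y \<inter> {..<n}"] by blast
    then have "m \<in> X \<inter> {..<n} \<longleftrightarrow> m \<in> Y \<inter> {..<n}" by (rule arg_cong)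
    ultimately show False using m by simp
  qed
  then have "branch X \<inter> branch Y \<subseteq> (\<lambda>n. prod_encode (n, set_encode (X \<inter> {..<n}))) ` {..m}"
    by (auto simp: branch_def)
  then show ?thesis
    by (rule finite_subset) simp
qed

section \<open>Coordinates on a Corson compactum\<close>

text \<open>By injectivity the closed conditions \<open>C p\<close> have only \<open>x\<close> in
  common, so finitely many of them already exclude the compact complement of
  \<open>U\<close>.\<close>

lemma finite_coordinates_nbhd:
  fixes \<phi> :: "'a::t2_space \<Rightarrow> 'i \<Rightarrow> real"
  assumes K: "compact (UNIV :: 'a set)" and cont: "\<And>i. continuous_on UNIV (\<lambda>x. \<phi> x i)"
    and inj: "inj \<phi>" and U: "open U" "x \<in> U"
  obtains F \<epsilon> where "finite F" "\<epsilon> > 0" "\<And>y. (\<And>i. i \<in> F \<Longrightarrow> \<bar>\<phi> y i - \<phi> x i\<bar> < \<epsilon>) \<Longrightarrow> y \<in> U"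
proof -
  define C where "C = (\<lambda>(i, n::nat). {y. \<bar>\<phi> y i - \<phi> x i\<bar> \<le> 1 / Suc n})"
  have C: "closed (C p)" for p
    unfolding C_def by (cases p) (auto intro!: closed_Collect_le continuous_intros cont)
  have "compact (- U)"
    using K U by (metis closed_Compl compact_Int_closed inf_top_left)
  moreover have "- U \<inter> (\<Inter>p\<in>UNIV. C p) = {}"
  proof -
    have "y = x" if y: "y \<in> (\<Inter>p\<in>UNIV. C p)" for y
    proof (rule injD[OF inj], rule ext)
      fix i
      have "\<bar>\<phi> y i - \<phi> x i\<bar> \<le> 1 / Suc n" for n
        using y by (auto simp: C_def)
      then have "\<bar>\<phi> y i - \<phi> x i\<bar> \<le> 0"
        by (intro LIMSEQ_le_const[OF lim_1_over_n[THEN LIMSEQ_Suc]]) auto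
      then show "\<phi> y i = \<phi> x i" by simp
    qed
    then show ?thesis using U by blast
  qed
  ultimately obtain I where I: "finite I" "- U \<inter> (\<Inter>p\<in>I. C p) = {}"
    using compact_imp_fip_image[of "- U" UNIV C] C by blast
  \<comment> \<open>A common bound turns the finitely many tolerances into a single radius.\<close>
  obtain N where N: "\<forall>n\<in>snd ` I. n \<le> N"
    using I(1) finite_nat_set_iff_bounded_le by blast
  show ?thesis
  proof (rule that[of "fst ` I" "1 / Suc N"])
    fix y assume y: "\<And>i. i \<in> fst ` I \<Longrightarrow> \<bar>\<phi> y i - \<phi> x i\<bar> < 1 / Suc N"
    have "y \<in> C p" if "p \<in> I" for p
    proof -
      obtain i n where p: "p = (i, n)" by (cases p)
      have "\<bar>\<phi> y i - \<phi> x i\<bar> < 1 / Suc N"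
        using y that p by force
      also have "\<dots> \<le> 1 / Suc n"
        using N that p by (auto simp: divide_simps)
      finally show ?thesis by (simp add: C_def p)
    qed
    then show "y \<in> U" using I(2) by blast
  qed (use I in auto)
qed

text \<open>An explicit tent function in finitely many coordinates works: outside \<open>U\<close> a
  single summand is already at least \<open>\<epsilon>\<close> and pushes the value to zero.\<close>

lemma bump_function:
  fixes \<phi> :: "'a::t2_space \<Rightarrow> 'i \<Rightarrow> real"
  assumes K: "compact (UNIV :: 'a set)" and cont: "\<And>i. continuous_on UNIV (\<lambda>x. \<phi> x i)"
    and inj: "inj \<phi>" and U: "open U" "x \<in> U"
  obtains f :: "'a \<Rightarrow>\<^sub>C real" where "f x = 1" "\<And>y. y \<notin> U \<Longrightarrow> f y = 0" "\<And>y. \<bar>f y\<bar> \<le> 1"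
proof -
  obtain F \<epsilon> where F: "finite F" "\<epsilon> > 0"
    and sub: "\<And>y. (\<And>i. i \<in> F \<Longrightarrow> \<bar>\<phi> y i - \<phi> x i\<bar> < \<epsilon>) \<Longrightarrow> y \<in> U"
    using finite_coordinates_nbhd[OF K cont inj U] by metis
  define g where "g y = max 0 (1 - (\<Sum>i\<in>F. \<bar>\<phi> y i - \<phi> x i\<bar>) / \<epsilon>)" for y
  have g1: "\<bar>g y\<bar> \<le> 1" for y
  proof -
    have "0 \<le> (\<Sum>i\<in>F. \<bar>\<phi> y i - \<phi> x i\<bar>) / \<epsilon>"
      using F by (intro divide_nonneg_pos sum_nonneg) auto
    then show ?thesis
      unfolding g_def by linarith
  qed
  have "g y = 0" if "y \<notin> U" for y
  proof -
    have "\<exists>i\<in>F. \<not> \<bar>\<phi> y i - \<phi> x i\<bar> < \<epsilon>"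
      using sub[of y] that by metis
    then obtain i where i: "i \<in> F" and "\<epsilon> \<le> \<bar>\<phi> y i - \<phi> x i\<bar>"
      by (auto simp: not_less)
    note this(2)
    also have "\<bar>\<phi> y i - \<phi> x i\<bar> \<le> (\<Sum>i\<in>F. \<bar>\<phi> y i - \<phi> x i\<bar>)"
      using i(1) F(1) by (intro member_le_sum) auto
    finally show ?thesis
      using F(2) by (simp add: g_def)
  qed
  moreover have "g \<in> bcontfun"
  proof (rule bcontfun_normI)
    show "continuous_on UNIV g"
      unfolding g_def using F by (intro continuous_intros cont) auto
  qed (use g1 in auto)
  ultimately show ?thesis
    using that[of "Bcontfun g"] g1 by (simp add: Bcontfun_inverse) (simp add: g_def)
qed

text \<open>Compactness in the square of the space: pairs with increment at least
  \<open>\<epsilon>\<close> form a compact set missing the diagonal, which is the intersection of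
  the closed sets \<open>C i\<close>.\<close>

lemma continuous_finitely_determined:
  fixes \<phi> :: "'a::t2_space \<Rightarrow> 'i \<Rightarrow> real" and f :: "'a \<Rightarrow> real"
  assumes K: "compact (UNIV :: 'a set)" and cont: "\<And>i. continuous_on UNIV (\<lambda>x. \<phi> x i)"
    and inj: "inj \<phi>" and f: "continuous_on UNIV f" and e: "\<epsilon> > 0"
  obtains F where "finite F" "\<And>a b. (\<And>i. i \<in> F \<Longrightarrow> \<phi> a i = \<phi> b i) \<Longrightarrow> \<bar>f a - f b\<bar> < \<epsilon>"
proof -
  define S where "S = {p. \<epsilon> \<le> \<bar>f (fst p) - f (snd p)\<bar>}"
  define C where "C i = {p. \<phi> (fst p) i = \<phi> (snd p) i}" for i
  have fs: "continuous_on UNIV (\<lambda>p::'a \<times> 'a. f (fst p))" "continuous_on UNIV (\<lambda>p::'a \<times> 'a. f (snd p))"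
    by (auto intro!: continuous_on_compose2[OF f] continuous_intros)
  have cs: "continuous_on UNIV (\<lambda>p::'a \<times> 'a. \<phi> (fst p) i)" "continuous_on UNIV (\<lambda>p::'a \<times> 'a. \<phi> (snd p) i)" for i
    by (auto intro!: continuous_on_compose2[OF cont] continuous_intros)
  have "closed S"
    unfolding S_def by (intro closed_Collect_le continuous_intros fs)
  then have "compact S"
    using compact_Times[OF K K] by (metis UNIV_Times_UNIV compact_Int_closed inf_top_left)
  moreover have "closed (C i)" for i
    unfolding C_def by (intro closed_Collect_eq cs)
  moreover have "S \<inter> (\<Inter>i\<in>UNIV. C i) = {}"
  proof -
    have "fst p = snd p" if "p \<in> (\<Inter>i\<in>UNIV. C i)" for p
      using that by (intro injD[OF inj]) (auto simp: C_def)
    then show ?thesis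
      using e by (force simp: S_def)
  qed
  ultimately obtain F where F: "finite F" "S \<inter> (\<Inter>i\<in>F. C i) = {}"
    using compact_imp_fip_image[of S UNIV C] by blast
  show ?thesis
  proof (rule that[OF F(1)])
    fix a b assume "\<And>i. i \<in> F \<Longrightarrow> \<phi> a i = \<phi> b i"
    then have "(a, b) \<in> (\<Inter>i\<in>F. C i)" by (auto simp: C_def)
    then have "(a, b) \<notin> S" using F(2) by blast
    then show "\<bar>f a - f b\<bar> < \<epsilon>" by (simp add: S_def)
  qed
qed

text \<open>\<open>J\<close> is closed off under choosing, for finitely many coordinates in \<open>J\<close> and
  rational targets, a point close to the targets and adding its support.\<close>
lemma retraction_coordinates:
  fixes \<phi> :: "'a::t2_space \<Rightarrow> 'i \<Rightarrow> real" and M :: "'m set"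
  assumes K: "compact (UNIV :: 'a set)" and cont: "\<And>i. continuous_on UNIV (\<lambda>x. \<phi> x i)"
    and ctb: "\<And>x. countable {i. \<phi> x i \<noteq> 0}"
    and M: "infinite M" and J0: "|J0| \<le>o |M|"
  obtains J D where "J0 \<subseteq> J" "|J| \<le>o |M|" "|D| \<le>o |M|"
    "\<forall>x. \<exists>y\<in>closure D. \<forall>i. \<phi> y i = (if i \<in> J then \<phi> x i else 0)"
proof -
  \<comment> \<open>If no point meets the targets, an arbitrary point is returned; its support is
    countable too, so the size count still holds.\<close>
  define pick where "pick ps n = (SOME x. \<forall>(i, q)\<in>set ps. \<bar>\<phi> x i - of_rat q\<bar> < 1 / Suc n)"
    for ps :: "('i \<times> rat) list" and n :: nat
  define A where "A X = lists (X \<times> (UNIV :: rat set)) \<times> (UNIV :: nat set)" for X :: "'i set"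
  define step where "step X = X \<union> (\<Union>(ps, n)\<in>A X. {i. \<phi> (pick ps n) i \<noteq> 0})" for X
  define J where "J = (\<Union>k. (step ^^ k) J0)"
  define D where "D = (\<lambda>(ps, n). pick ps n) ` A J"
  have ctbM: "|C| \<le>o |M|" if "countable C" for C :: "'c set"
    using card_of_countable_ordLeq_infinite[OF that M] .
  have A: "|A X| \<le>o |M|" if "|X| \<le>o |M|" for X
    unfolding A_def
    by (rule card_of_Sigma_ordLeq_infinite[OF M card_of_lists_ordLeq_infinite[OF M]],
        rule card_of_Sigma_ordLeq_infinite[OF M that]) (auto intro: ctbM)
  have step: "|step X| \<le>o |M|" if "|X| \<le>o |M|" for X
  proof -
    have "|\<Union>(ps, n)\<in>A X. {i. \<phi> (pick ps n) i \<noteq> 0}| \<le>o |M|"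
      by (rule card_of_UNION_ordLeq_infinite[OF M A[OF that]]) (auto intro: ctbM ctb)
    then have "|\<Union>b. if b then X else \<Union>(ps, n)\<in>A X. {i. \<phi> (pick ps n) i \<noteq> 0}| \<le>o |M|"
      using that by (intro card_of_UNION_ordLeq_infinite[OF M]) (auto intro: ctbM)
    moreover have "step X = (\<Union>b. if b then X else \<Union>(ps, n)\<in>A X. {i. \<phi> (pick ps n) i \<noteq> 0})"
      by (auto simp: step_def UNIV_bool)
    ultimately show ?thesis by simp
  qed
  have Jk: "|(step ^^ k) J0| \<le>o |M|" for k
    by (induction k) (auto simp: J0 step)
  have J: "|J| \<le>o |M|"
    unfolding J_def by (rule card_of_UNION_ordLeq_infinite[OF M]) (auto intro: ctbM Jk)
  have D: "|D| \<le>o |M|"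
    unfolding D_def by (rule ordLeq_transitive[OF card_of_image A[OF J]])
  \<comment> \<open>Since the stages increase, finitely many coordinates of \<open>J\<close> lie in
    one stage, and the point picked for them has its support in the next.\<close>
  have "mono (\<lambda>k. (step ^^ k) J0)"
    by (rule mono_iff_le_Suc[THEN iffD2]) (auto simp: step_def)
  then have mono: "(step ^^ k) J0 \<subseteq> (step ^^ l) J0" if "k \<le> l" for k l
    using that by (auto dest: monoD)
  have level: "\<exists>k. F \<subseteq> (step ^^ k) J0" if "finite F" "F \<subseteq> J" for F
    using that
  proof (induction F)
    case (insert i F)
    then obtain k l where "F \<subseteq> (step ^^ k) J0" "i \<in> (step ^^ l) J0"
      by (auto simp: J_def)
    then have "insert i F \<subseteq> (step ^^ max k l) J0"
      using mono[of k "max k l"] mono[of l "max k l"] by auto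
    then show ?case by blast
  qed auto
  have supp: "\<phi> (pick ps n) i = 0" if ps: "ps \<in> lists (J \<times> UNIV)" and i: "i \<notin> J" for ps n i
  proof (rule ccontr)
    assume ne: "\<phi> (pick ps n) i \<noteq> 0"
    have "fst ` set ps \<subseteq> J"
      using ps by (auto simp: in_lists_conv_set)
    then obtain k where "fst ` set ps \<subseteq> (step ^^ k) J0"
      using level[of "fst ` set ps"] by blast
    then have "(ps, n) \<in> A ((step ^^ k) J0)"
      by (auto simp: A_def in_lists_conv_set)
    then have "i \<in> (step ^^ Suc k) J0"
      using ne by (auto simp: step_def)
    then show False
      using i unfolding J_def by blast
  qed
  have retr: "\<exists>y\<in>closure D. \<forall>i. \<phi> y i = (if i \<in> J then \<phi> x i else 0)" for x
  proof -
    define z where "z i = (if i \<in> J then \<phi> x i else 0)" for i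
    define C where "C = (\<lambda>(i, n::nat). {y. \<bar>\<phi> y i - z i\<bar> \<le> 1 / Suc n})"
    have C: "closed (C p)" for p
      unfolding C_def by (cases p) (auto intro!: closed_Collect_le continuous_intros cont)
    have cl: "compact (closure D)"
      using K by (metis closed_closure compact_Int_closed inf_top_left)
    \<comment> \<open>By compactness it suffices to meet finitely many tolerances at once, and a
      point of \<open>D\<close> does so.\<close>
    have fip: "closure D \<inter> (\<Inter>p\<in>I. C p) \<noteq> {}" if I: "finite I" for I
    proof -
      obtain N where N: "\<forall>n\<in>snd ` I. n \<le> N"
        using I finite_nat_set_iff_bounded_le by blast
      obtain xs where xs: "set xs = fst ` I \<inter> J"
        using I finite_list[of "fst ` I \<inter> J"] by auto
      \<comment> \<open>Twice this tolerance is \<open>1 / Suc N\<close>: one share for the rational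
        target, one for the picked point.\<close>
      have "\<exists>q. \<bar>\<phi> x i - of_rat q\<bar> < 1 / Suc (2 * N + 1)" for i
      proof -
        obtain q where "\<phi> x i - 1 / Suc (2 * N + 1) < of_rat q" "of_rat q < \<phi> x i"
          using of_rat_dense[of "\<phi> x i - 1 / Suc (2 * N + 1)" "\<phi> x i"] by auto
        then show ?thesis by (intro exI[of _ q]) linarith
      qed
      then obtain q where q: "\<And>i. \<bar>\<phi> x i - of_rat (q i)\<bar> < 1 / Suc (2 * N + 1)" by metis
      define ps where "ps = map (\<lambda>i. (i, q i)) xs"
      define d where "d = pick ps (2 * N + 1)"
      \<comment> \<open>The point \<open>x\<close> itself meets the targets, so the choice in
        \<open>pick\<close> is a genuine one.\<close>
      have "\<forall>(i, q)\<in>set ps. \<bar>\<phi> x i - of_rat q\<bar> < 1 / Suc (2 * N + 1)"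
        using q by (auto simp: ps_def)
      then have d: "\<forall>(i, q)\<in>set ps. \<bar>\<phi> d i - of_rat q\<bar> < 1 / Suc (2 * N + 1)"
        unfolding d_def pick_def by (rule someI)
      have ps: "ps \<in> lists (J \<times> UNIV)"
        using xs by (auto simp: ps_def in_lists_conv_set)
      have "d \<in> C p" if "p \<in> I" for p
      proof -
        obtain i n where p: "p = (i, n)" by (cases p)
        have n: "1 / Suc N \<le> 1 / Suc n"
          using N that p by (auto simp: divide_simps)
        have "\<bar>\<phi> d i - z i\<bar> \<le> 1 / Suc N"
        proof (cases "i \<in> J")
          case True
          then have "i \<in> set xs" using xs that p by force
          then have "\<bar>\<phi> d i - of_rat (q i)\<bar> < 1 / Suc (2 * N + 1)"
            using d by (auto simp: ps_def)
          moreover have "1 / Suc (2 * N + 1) + 1 / Suc (2 * N + 1) = (1 / Suc N :: real)"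
            by (simp add: field_simps)
          ultimately show ?thesis
            using q[of i] unfolding z_def if_P[OF True] by linarith
        next
          case False
          then show ?thesis
            using supp[OF ps] by (simp add: z_def d_def)
        qed
        then show ?thesis
          using n by (simp add: C_def p del: of_nat_Suc)
      qed
      moreover have "d \<in> closure D"
        using ps by (intro subsetD[OF closure_subset]) (auto simp: D_def A_def d_def)
      ultimately show ?thesis by blast
    qed
    have "closure D \<inter> (\<Inter>p\<in>UNIV. C p) \<noteq> {}"
      by (rule compact_imp_fip_image[OF cl C fip])
    then obtain y where y: "y \<in> closure D" "\<And>p. y \<in> C p"
      by auto
    have "\<phi> y i = z i" for i
    proof -
      have "\<bar>\<phi> y i - z i\<bar> \<le> 1 / Suc n" for n
        using y(2)[of "(i, n)"] by (simp add: C_def)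
      then have "\<bar>\<phi> y i - z i\<bar> \<le> 0"
        by (intro LIMSEQ_le_const[OF lim_1_over_n[THEN LIMSEQ_Suc]]) auto
      then show ?thesis by simp
    qed
    with y(1) show ?thesis
      unfolding z_def by blast
  qed
  have "(step ^^ 0) J0 \<subseteq> J"
    unfolding J_def by (rule UN_upper) simp
  then have "J0 \<subseteq> J" by simp
  then show ?thesis
    using that J D retr by blast
qed

section \<open>The twisted sum of an almost disjoint family\<close>

text \<open>The pullback of \<open>\<ell>\<^sub>\<infinity> \<rightarrow> \<ell>\<^sub>\<infinity>/c\<^sub>0\<close> along the operator sending \<open>f\<close> to the class of
  \<open>\<Sum>\<alpha>. (f (a \<alpha>) - f (b \<alpha>)) 1\<^bsub>A \<alpha>\<^esub>\<close>; that class is described by its limits along each \<open>A \<alpha>\<close> and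
  its smallness off finitely many of them.\<close>
definition ad_pullback ::
  "'l set \<Rightarrow> ('l \<Rightarrow> nat set) \<Rightarrow> ('l \<Rightarrow> 'a) \<Rightarrow> ('l \<Rightarrow> 'a) \<Rightarrow> ((nat \<Rightarrow>\<^sub>C real) \<times> ('a::topological_space \<Rightarrow>\<^sub>C real)) set"
  where
  "ad_pullback \<Lambda> A a b = {(y :: nat \<Rightarrow>\<^sub>C real, f :: 'a \<Rightarrow>\<^sub>C real).
     (\<forall>\<epsilon>>0. \<forall>\<alpha>\<in>\<Lambda>. finite {p \<in> A \<alpha>. \<epsilon> \<le> \<bar>y p - (f (a \<alpha>) - f (b \<alpha>))\<bar>}) \<and>
     (\<forall>\<epsilon>>0. \<exists>G\<subseteq>\<Lambda>. finite G \<and> finite {p. p \<notin> (\<Union>\<alpha>\<in>G. A \<alpha>) \<and> \<epsilon> \<le> \<bar>y p\<bar>})}"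

lemma ad_pullback_add:
  fixes y z :: "nat \<Rightarrow>\<^sub>C real" and f g :: "'a::topological_space \<Rightarrow>\<^sub>C real"
  assumes "(y, f) \<in> ad_pullback \<Lambda> A a b" "(z, g) \<in> ad_pullback \<Lambda> A a b"
  shows "(y + z, f + g) \<in> ad_pullback \<Lambda> A a b"
  unfolding ad_pullback_def mem_Collect_eq prod.case
proof (intro conjI allI impI ballI)
  fix \<epsilon> :: real and \<alpha> assume "\<epsilon> > 0" "\<alpha> \<in> \<Lambda>"
  then have "\<epsilon> / 2 > 0" by simp
  then have "finite ({p \<in> A \<alpha>. \<epsilon> / 2 \<le> \<bar>y p - (f (a \<alpha>) - f (b \<alpha>))\<bar>} \<union> {p \<in> A \<alpha>. \<epsilon> / 2 \<le> \<bar>z p - (g (a \<alpha>) - g (b \<alpha>))\<bar>})"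
    using assms \<open>\<alpha> \<in> \<Lambda>\<close> unfolding ad_pullback_def by blast
  moreover have "\<epsilon> / 2 \<le> \<bar>y p - (f (a \<alpha>) - f (b \<alpha>))\<bar> \<or> \<epsilon> / 2 \<le> \<bar>z p - (g (a \<alpha>) - g (b \<alpha>))\<bar>"
    if "\<epsilon> \<le> \<bar>(y + z) p - ((f + g) (a \<alpha>) - (f + g) (b \<alpha>))\<bar>" for p
  proof (rule ccontr)
    assume "\<not> (\<epsilon> / 2 \<le> \<bar>y p - (f (a \<alpha>) - f (b \<alpha>))\<bar> \<or> \<epsilon> / 2 \<le> \<bar>z p - (g (a \<alpha>) - g (b \<alpha>))\<bar>)"
    with that show False
      unfolding plus_bcontfun.rep_eq de_Morgan_disj by linarith
  qed
  ultimately show "finite {p \<in> A \<alpha>. \<epsilon> \<le> \<bar>(y + z) p - ((f + g) (a \<alpha>) - (f + g) (b \<alpha>))\<bar>}"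
    by (elim rev_finite_subset) blast
next
  fix \<epsilon> :: real assume "\<epsilon> > 0"
  then have e: "\<epsilon> / 2 > 0" by simp
  obtain G where G: "G \<subseteq> \<Lambda>" "finite G" "finite {p. p \<notin> (\<Union>\<alpha>\<in>G. A \<alpha>) \<and> \<epsilon> / 2 \<le> \<bar>y p\<bar>}"
    using assms(1) e unfolding ad_pullback_def by blast
  obtain H where H: "H \<subseteq> \<Lambda>" "finite H" "finite {p. p \<notin> (\<Union>\<alpha>\<in>H. A \<alpha>) \<and> \<epsilon> / 2 \<le> \<bar>z p\<bar>}"
    using assms(2) e unfolding ad_pullback_def by blast
  have "finite {p. p \<notin> (\<Union>\<alpha>\<in>G \<union> H. A \<alpha>) \<and> \<epsilon> \<le> \<bar>(y + z) p\<bar>}"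
    by (rule finite_subset[OF _ finite_UnI[OF G(3) H(3)]]) auto
  then show "\<exists>G\<subseteq>\<Lambda>. finite G \<and> finite {p. p \<notin> (\<Union>\<alpha>\<in>G. A \<alpha>) \<and> \<epsilon> \<le> \<bar>(y + z) p\<bar>}"
    using G(1,2) H(1,2) by (intro exI[of _ "G \<union> H"]) simp
qed

lemma zero_in_ad_pullback: "(0, 0) \<in> ad_pullback \<Lambda> A a b"
  unfolding ad_pullback_def by (auto intro!: exI[of _ "{}"])

lemma ad_pullback_scale:
  fixes y :: "nat \<Rightarrow>\<^sub>C real" and f :: "'a::topological_space \<Rightarrow>\<^sub>C real"
  assumes "(y, f) \<in> ad_pullback \<Lambda> A a b"
  shows "(c *\<^sub>R y, c *\<^sub>R f) \<in> ad_pullback \<Lambda> A a b"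
proof (cases "c = 0")
  case True
  then show ?thesis by (simp add: zero_in_ad_pullback)
next
  case False
  have le: "\<epsilon> \<le> \<bar>c\<bar> * \<bar>t\<bar> \<longleftrightarrow> \<epsilon> / \<bar>c\<bar> \<le> \<bar>t\<bar>" for \<epsilon> t :: real
    using False by (simp add: divide_simps mult.commute)
  have e: "\<epsilon> / \<bar>c\<bar> > 0" if "\<epsilon> > 0" for \<epsilon> :: real
    using that False by simp
  have d: "c * y p - (c * s - c * t) = c * (y p - (s - t))" for p s t
    by (simp add: algebra_simps)
  show ?thesis
    using assms e unfolding ad_pullback_def
    by (simp add: d abs_mult le)
qed

lemma subspace_ad_pullback: "subspace (ad_pullback \<Lambda> A a b)"
  by (rule subspaceI)
    (auto simp: zero_in_ad_pullback ad_pullback_add ad_pullback_scale zero_prod_def)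

lemma closed_ad_pullback:
  fixes a b :: "'l \<Rightarrow> 'b::topological_space"
  shows "closed (ad_pullback \<Lambda> A a b)"
proof -
  have "(y, f) \<in> ad_pullback \<Lambda> A a b" if cl: "(y, f) \<in> closure (ad_pullback \<Lambda> A a b)"
    for y :: "nat \<Rightarrow>\<^sub>C real" and f :: "'b \<Rightarrow>\<^sub>C real"
  proof -
    have near: "\<exists>(z :: nat \<Rightarrow>\<^sub>C real) (g :: 'b \<Rightarrow>\<^sub>C real). (z, g) \<in> ad_pullback \<Lambda> A a b \<and> (\<forall>p. \<bar>y p - z p\<bar> < \<epsilon>) \<and> (\<forall>x. \<bar>f x - g x\<bar> < \<epsilon>)"
      if "\<epsilon> > 0" for \<epsilon>
    proof -
      obtain z g where zg: "(z, g) \<in> ad_pullback \<Lambda> A a b" "dist (z, g) (y, f) < \<epsilon>"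
        using cl \<open>\<epsilon> > 0\<close> unfolding closure_approachable by auto
      have "dist z y < \<epsilon>" "dist g f < \<epsilon>"
        using dist_fst_le[of "(z, g)" "(y, f)"] dist_snd_le[of "(z, g)" "(y, f)"] zg(2) by auto
      then have "dist (y p) (z p) < \<epsilon>" "dist (f x) (g x) < \<epsilon>" for p x
        by (metis dist_commute dist_fun_lt_imp_dist_val_lt)+
      with zg(1) show ?thesis unfolding dist_real_def by blast
    qed
    show ?thesis
      unfolding ad_pullback_def mem_Collect_eq prod.case
    proof (intro conjI allI impI ballI)
      fix \<epsilon> :: real and \<alpha> assume "\<epsilon> > 0" "\<alpha> \<in> \<Lambda>"
      \<comment> \<open>Three errors below \<open>\<epsilon>/6\<close>, at \<open>p\<close>,
        \<open>a \<alpha>\<close> and \<open>b \<alpha>\<close>, together stay below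
        \<open>\<epsilon>/2\<close>.\<close>
      then obtain z g where zg: "(z, g) \<in> ad_pullback \<Lambda> A a b"
        and y: "\<And>p. \<bar>y p - z p\<bar> < \<epsilon>/6" and f: "\<And>x. \<bar>f x - g x\<bar> < \<epsilon>/6"
        using near[of "\<epsilon>/6"] by auto
      have "finite {p \<in> A \<alpha>. \<epsilon> / 2 \<le> \<bar>z p - (g (a \<alpha>) - g (b \<alpha>))\<bar>}"
        using zg half_gt_zero[OF \<open>\<epsilon> > 0\<close>] \<open>\<alpha> \<in> \<Lambda>\<close> unfolding ad_pullback_def by blast
      moreover have "\<epsilon> / 2 \<le> \<bar>z p - (g (a \<alpha>) - g (b \<alpha>))\<bar>" if "\<epsilon> \<le> \<bar>y p - (f (a \<alpha>) - f (b \<alpha>))\<bar>" for p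
        using that y[of p] f[of "a \<alpha>"] f[of "b \<alpha>"] by linarith
      ultimately show "finite {p \<in> A \<alpha>. \<epsilon> \<le> \<bar>y p - (f (a \<alpha>) - f (b \<alpha>))\<bar>}"
        by (elim rev_finite_subset) blast
    next
      fix \<epsilon> :: real assume "\<epsilon> > 0"
      then obtain z g where zg: "(z, g) \<in> ad_pullback \<Lambda> A a b"
        and y: "\<And>p. \<bar>y p - z p\<bar> < \<epsilon>/2"
        using near[of "\<epsilon>/2"] by auto
      obtain G where G: "G \<subseteq> \<Lambda>" "finite G" "finite {p. p \<notin> (\<Union>\<alpha>\<in>G. A \<alpha>) \<and> \<epsilon>/2 \<le> \<bar>z p\<bar>}"
        using zg half_gt_zero[OF \<open>\<epsilon> > 0\<close>] unfolding ad_pullback_def by blast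
      have "\<epsilon>/2 \<le> \<bar>z p\<bar>" if "\<epsilon> \<le> \<bar>y p\<bar>" for p
        using that y[of p] by linarith
      then have "finite {p. p \<notin> (\<Union>\<alpha>\<in>G. A \<alpha>) \<and> \<epsilon> \<le> \<bar>y p\<bar>}"
        by (intro finite_subset[OF _ G(3)]) blast
      with G(1,2) show "\<exists>G\<subseteq>\<Lambda>. finite G \<and> finite {p. p \<notin> (\<Union>\<alpha>\<in>G. A \<alpha>) \<and> \<epsilon> \<le> \<bar>y p\<bar>}"
        by blast
    qed
  qed
  then show ?thesis
    by (metis closed_closure closure_subset subset_antisym subrelI)
qed

lemma c0_iff_finite:
  fixes y :: "nat \<Rightarrow>\<^sub>C real"
  shows "y \<in> c0 \<longleftrightarrow> (\<forall>\<epsilon>>0. finite {p. \<epsilon> \<le> \<bar>y p\<bar>})"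
proof -
  have "(\<exists>N. \<forall>p\<ge>N. \<bar>y p\<bar> < \<epsilon>) \<longleftrightarrow> finite {p. \<epsilon> \<le> \<bar>y p\<bar>}" for \<epsilon>
    unfolding finite_nat_set_iff_bounded by (auto simp: not_le[symmetric]) 
  then show ?thesis
    by (simp add: c0_def LIMSEQ_iff)
qed

text \<open>For \<open>f = 0\<close> the first clause makes \<open>y\<close> null along each
  \<open>A \<alpha>\<close>, the second off finitely many of them. This identifies the kernel of
  \<open>snd\<close> with \<open>c0\<close>.\<close>

lemma c0_iff_ad_pullback:
  fixes y :: "nat \<Rightarrow>\<^sub>C real"
  shows "y \<in> c0 \<longleftrightarrow> (y, 0) \<in> ad_pullback \<Lambda> A a b"
proof
  assume y: "y \<in> c0"
  then have "finite {p. p \<notin> (\<Union>\<alpha>\<in>{}. A \<alpha>) \<and> \<epsilon> \<le> \<bar>y p\<bar>}" if "\<epsilon> > 0" for \<epsilon>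
    using that by (simp add: c0_iff_finite)
  moreover have "finite {p \<in> A \<alpha>. \<epsilon> \<le> \<bar>y p\<bar>}" if "\<epsilon> > 0" for \<epsilon> \<alpha>
    using y that unfolding c0_iff_finite by (auto intro: rev_finite_subset)
  ultimately show "(y, 0) \<in> ad_pullback \<Lambda> A a b"
    unfolding ad_pullback_def by (auto intro!: exI[of _ "{}"])
next
  assume y: "(y, 0) \<in> ad_pullback \<Lambda> A a b"
  show "y \<in> c0"
    unfolding c0_iff_finite
  proof (intro allI impI)
    fix \<epsilon> :: real assume "\<epsilon> > 0"
    then obtain G where G: "G \<subseteq> \<Lambda>" "finite G" "finite {p. p \<notin> (\<Union>\<alpha>\<in>G. A \<alpha>) \<and> \<epsilon> \<le> \<bar>y p\<bar>}"
      using y unfolding ad_pullback_def by blast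
    have "finite {p \<in> A \<alpha>. \<epsilon> \<le> \<bar>y p\<bar>}" if "\<alpha> \<in> G" for \<alpha>
      using y \<open>\<epsilon> > 0\<close> G(1) that unfolding ad_pullback_def by auto
    then have "finite (\<Union>\<alpha>\<in>G. {p \<in> A \<alpha>. \<epsilon> \<le> \<bar>y p\<bar>})"
      using G(2) by blast
    from finite_UnI[OF this G(3)] show "finite {p. \<epsilon> \<le> \<bar>y p\<bar>}"
      by (rule rev_finite_subset) auto
  qed
qed

text \<open>The value at \<open>p\<close> is the increment of largest modulus among the indices with \<open>p \<in> A \<alpha>\<close>.\<close>
lemma ad_pullback_surj:
  fixes a b :: "'l \<Rightarrow> 'a::topological_space" and f :: "'a \<Rightarrow>\<^sub>C real"
  assumes ad: "\<And>\<alpha> \<beta>. \<alpha> \<in> \<Lambda> \<Longrightarrow> \<beta> \<in> \<Lambda> \<Longrightarrow> \<alpha> \<noteq> \<beta> \<Longrightarrow> finite (A \<alpha> \<inter> A \<beta>)"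
    and null: "\<And>\<epsilon>. \<epsilon> > 0 \<Longrightarrow> finite {\<alpha> \<in> \<Lambda>. \<epsilon> \<le> \<bar>f (a \<alpha>) - f (b \<alpha>)\<bar>}"
  obtains y where "(y, f) \<in> ad_pullback \<Lambda> A a b"
proof -
  define d where "d \<alpha> = f (a \<alpha>) - f (b \<alpha>)" for \<alpha>
  have bound: "\<bar>d \<alpha>\<bar> \<le> 2 * norm f" for \<alpha>
    using norm_bounded[of f "a \<alpha>"] norm_bounded[of f "b \<alpha>"] by (simp add: d_def)
  have null_d: "finite {\<alpha> \<in> \<Lambda>. \<epsilon> \<le> \<bar>d \<alpha>\<bar>}" if "\<epsilon> > 0" for \<epsilon>
    using null[OF that] by (simp add: d_def)
  \<comment> \<open>Zero is the default when all increments at \<open>p\<close> vanish; otherwise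
    only finitely many increments reach a given nonzero modulus, so a largest one exists.\<close>
  have "\<exists>t. ((\<exists>\<alpha>\<in>\<Lambda>. p \<in> A \<alpha> \<and> t = d \<alpha>) \<or> t = 0) \<and> (\<forall>\<alpha>\<in>\<Lambda>. p \<in> A \<alpha> \<longrightarrow> \<bar>d \<alpha>\<bar> \<le> \<bar>t\<bar>)" for p
  proof (cases "\<exists>\<alpha>\<in>\<Lambda>. p \<in> A \<alpha> \<and> d \<alpha> \<noteq> 0")
    case True
    then obtain \<alpha> where \<alpha>: "\<alpha> \<in> \<Lambda>" "p \<in> A \<alpha>" "d \<alpha> \<noteq> 0" by blast
    define Q where "Q = {\<beta> \<in> \<Lambda>. p \<in> A \<beta> \<and> \<bar>d \<alpha>\<bar> \<le> \<bar>d \<beta>\<bar>}"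
    have "finite Q"
      by (rule finite_subset[OF _ null_d[of "\<bar>d \<alpha>\<bar>"]]) (use \<alpha> in \<open>auto simp: Q_def\<close>)
    moreover have "\<alpha> \<in> Q" using \<alpha> by (simp add: Q_def)
    ultimately have "Max ((\<lambda>\<gamma>. \<bar>d \<gamma>\<bar>) ` Q) \<in> (\<lambda>\<gamma>. \<bar>d \<gamma>\<bar>) ` Q"
      by (intro Max_in) auto
    then obtain \<beta> where "\<beta> \<in> Q" "Max ((\<lambda>\<gamma>. \<bar>d \<gamma>\<bar>) ` Q) = \<bar>d \<beta>\<bar>" by blast
    then have \<beta>: "\<beta> \<in> Q" "\<And>\<gamma>. \<gamma> \<in> Q \<Longrightarrow> \<bar>d \<gamma>\<bar> \<le> \<bar>d \<beta>\<bar>"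
      using \<open>finite Q\<close> by (metis Max_ge finite_imageI image_eqI)+
    have "\<bar>d \<gamma>\<bar> \<le> \<bar>d \<beta>\<bar>" if "\<gamma> \<in> \<Lambda>" "p \<in> A \<gamma>" for \<gamma>
    proof (cases "\<gamma> \<in> Q")
      case False
      then have "\<bar>d \<gamma>\<bar> \<le> \<bar>d \<alpha>\<bar>"
        using that by (auto simp: Q_def)
      with \<beta>(2)[OF \<open>\<alpha> \<in> Q\<close>] show ?thesis by linarith
    qed (rule \<beta>(2))
    with \<beta>(1) show ?thesis
      by (intro exI[of _ "d \<beta>"]) (auto simp: Q_def)
  qed auto
  then obtain t where t: "\<And>p. (\<exists>\<alpha>\<in>\<Lambda>. p \<in> A \<alpha> \<and> t p = d \<alpha>) \<or> t p = 0"
    and max: "\<And>p \<alpha>. \<alpha> \<in> \<Lambda> \<Longrightarrow> p \<in> A \<alpha> \<Longrightarrow> \<bar>d \<alpha>\<bar> \<le> \<bar>t p\<bar>"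
    by metis
  have "\<bar>t p\<bar> \<le> 2 * norm f" for p
    using t[of p] bound by auto
  then have "t \<in> bcontfun"
    by (intro bcontfun_normI[of _ "2 * norm f"]) auto
  then have y: "apply_bcontfun (Bcontfun t) = t"
    by (rule Bcontfun_inverse)
  have "finite {p \<in> A \<alpha>. \<epsilon> \<le> \<bar>t p - d \<alpha>\<bar>}" if "\<epsilon> > 0" "\<alpha> \<in> \<Lambda>" for \<epsilon> \<alpha>
  proof -
    \<comment> \<open>\<open>H\<close> contains every index that can supply a bad value on
      \<open>A \<alpha>\<close>: by maximality its increment has modulus at least that of
      \<open>d \<alpha>\<close>, or at least \<open>\<epsilon>\<close> when
      \<open>d \<alpha>\<close> is zero.\<close>
    define H where "H = {\<beta> \<in> \<Lambda>. (if d \<alpha> = 0 then \<epsilon> else \<bar>d \<alpha>\<bar>) \<le> \<bar>d \<beta>\<bar>} - {\<alpha>}"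
    have "finite H"
      unfolding H_def using \<open>\<epsilon> > 0\<close> by (intro finite_Diff null_d) auto
    moreover have "finite (A \<alpha> \<inter> A \<beta>)" if "\<beta> \<in> H" for \<beta>
      using that \<open>\<alpha> \<in> \<Lambda>\<close> by (intro ad) (auto simp: H_def)
    ultimately have "finite (\<Union>\<beta>\<in>H. A \<alpha> \<inter> A \<beta>)" by blast
    moreover have "p \<in> (\<Union>\<beta>\<in>H. A \<alpha> \<inter> A \<beta>)" if p: "p \<in> A \<alpha>" "\<epsilon> \<le> \<bar>t p - d \<alpha>\<bar>" for p
    proof -
      have "t p \<noteq> d \<alpha>" using p(2) \<open>\<epsilon> > 0\<close> by auto
      moreover have "\<bar>d \<alpha>\<bar> \<le> \<bar>t p\<bar>"
        using max \<open>\<alpha> \<in> \<Lambda>\<close> p(1) by blast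
      ultimately have "t p \<noteq> 0" by auto
      then obtain \<beta> where \<beta>: "\<beta> \<in> \<Lambda>" "p \<in> A \<beta>" "t p = d \<beta>"
        using t by blast
      have "\<beta> \<in> H"
        using \<beta> p(2) \<open>t p \<noteq> d \<alpha>\<close> \<open>\<bar>d \<alpha>\<bar> \<le> \<bar>t p\<bar>\<close> by (auto simp: H_def)
      with \<beta>(2) p(1) show ?thesis by blast
    qed
    ultimately show ?thesis
      by (elim rev_finite_subset) blast
  qed
  moreover have "\<exists>G\<subseteq>\<Lambda>. finite G \<and> finite {p. p \<notin> (\<Union>\<alpha>\<in>G. A \<alpha>) \<and> \<epsilon> \<le> \<bar>t p\<bar>}" if "\<epsilon> > 0" for \<epsilon>
  proof -
    \<comment> \<open>A large value is itself a large increment, so no exceptional \<open>p\<close>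
      remains at all.\<close>
    have "p \<in> (\<Union>\<alpha>\<in>{\<alpha> \<in> \<Lambda>. \<epsilon> \<le> \<bar>d \<alpha>\<bar>}. A \<alpha>)" if "\<epsilon> \<le> \<bar>t p\<bar>" for p
    proof -
      have "t p \<noteq> 0" using that \<open>\<epsilon> > 0\<close> by auto
      then obtain \<alpha> where "\<alpha> \<in> \<Lambda>" "p \<in> A \<alpha>" "t p = d \<alpha>"
        using t[of p] by blast
      with that show ?thesis by auto
    qed
    then have "{p. p \<notin> (\<Union>\<alpha>\<in>{\<alpha> \<in> \<Lambda>. \<epsilon> \<le> \<bar>d \<alpha>\<bar>}. A \<alpha>) \<and> \<epsilon> \<le> \<bar>t p\<bar>} = {}"
      by blast
    then have "finite {p. p \<notin> (\<Union>\<alpha>\<in>{\<alpha> \<in> \<Lambda>. \<epsilon> \<le> \<bar>d \<alpha>\<bar>}. A \<alpha>) \<and> \<epsilon> \<le> \<bar>t p\<bar>}"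
      by (rule ssubst) simp
    then show ?thesis
      using null_d[OF that] by (intro exI[of _ "{\<alpha> \<in> \<Lambda>. \<epsilon> \<le> \<bar>d \<alpha>\<bar>}"] conjI) auto
  qed
  ultimately have "(Bcontfun t, f) \<in> ad_pullback \<Lambda> A a b"
    unfolding ad_pullback_def by (simp add: y d_def)
  then show ?thesis by (rule that)
qed

lemma twisted_sum_ad_pullback:
  fixes a b :: "'l \<Rightarrow> 'a::topological_space"
  assumes ad: "\<And>\<alpha> \<beta>. \<alpha> \<in> \<Lambda> \<Longrightarrow> \<beta> \<in> \<Lambda> \<Longrightarrow> \<alpha> \<noteq> \<beta> \<Longrightarrow> finite (A \<alpha> \<inter> A \<beta>)"
    and null: "\<And>(f :: 'a \<Rightarrow>\<^sub>C real) \<epsilon>. \<epsilon> > 0 \<Longrightarrow> finite {\<alpha> \<in> \<Lambda>. \<epsilon> \<le> \<bar>f (a \<alpha>) - f (b \<alpha>)\<bar>}"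
  shows "twisted_sum c0 norm (UNIV :: ('a \<Rightarrow>\<^sub>C real) set) norm (ad_pullback \<Lambda> A a b) norm (\<lambda>y. (y, 0)) snd"
proof -
  let ?Z = "ad_pullback \<Lambda> A a b"
  \<comment> \<open>As a preimage of the pullback, \<open>c0\<close> inherits being a closed
    subspace.\<close>
  have c0: "c0 = (\<lambda>y. (y, 0)) -` ?Z"
    by (auto simp: c0_iff_ad_pullback[of _ \<Lambda> A a b])
  have lin: "linear (\<lambda>y :: nat \<Rightarrow>\<^sub>C real. (y, 0 :: 'a \<Rightarrow>\<^sub>C real))"
    by (rule linearI) auto
  have "banach_on c0 (norm :: (nat \<Rightarrow>\<^sub>C real) \<Rightarrow> real)"
  proof (rule banach_on_closed_subspace)
    show "subspace c0"
      unfolding c0 vimage_def by (rule real_vector.linear_subspace_vimage[OF lin subspace_ad_pullback, unfolded vimage_def])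
    show "closed c0"
      unfolding c0 by (intro continuous_closed_vimage closed_ad_pullback continuous_intros)
  qed
  moreover have "banach_on (UNIV :: ('a \<Rightarrow>\<^sub>C real) set) norm"
    by (intro banach_on_closed_subspace) auto
  moreover have "banach_on ?Z norm"
    by (intro banach_on_closed_subspace subspace_ad_pullback closed_ad_pullback)
  moreover have "bounded_linear_on c0 norm ?Z norm (\<lambda>y. (y, 0))"
    unfolding bounded_linear_on_def
    by (auto simp: c0_iff_ad_pullback[of _ \<Lambda> A a b] norm_Pair intro!: exI[of _ 1])
  moreover have "bounded_linear_on ?Z norm (UNIV :: ('a \<Rightarrow>\<^sub>C real) set) norm snd"
    unfolding bounded_linear_on_def using norm_snd_le by (auto intro!: exI[of _ 1])
  moreover have "inj_on (\<lambda>y. (y, 0 :: 'a \<Rightarrow>\<^sub>C real)) c0"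
    by (rule inj_onI) simp
  moreover have "(\<lambda>y. (y, 0)) ` c0 = {z \<in> ?Z. snd z = 0}"
    by (auto simp: c0_iff_ad_pullback[of _ \<Lambda> A a b])
  moreover have "snd ` ?Z = UNIV"
  proof -
    have "f \<in> snd ` ?Z" for f
    proof -
      obtain y where "(y, f) \<in> ?Z"
        using ad_pullback_surj[of \<Lambda> A f a b, OF ad null] .
      then show ?thesis by force
    qed
    then show ?thesis by blast
  qed
  ultimately show ?thesis
    unfolding twisted_sum_def by blast
qed

text \<open>A closed complement of \<open>c0\<close> in the pullback is the graph of a linear map
  \<open>L\<close>, which the closed graph theorem bounds; \<open>S p\<close> is its
  \<open>p\<close>-th coordinate.\<close>

lemma bounded_lifting:
  fixes a b :: "'l \<Rightarrow> 'a::topological_space"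
  assumes ad: "\<And>\<alpha> \<beta>. \<alpha> \<in> \<Lambda> \<Longrightarrow> \<beta> \<in> \<Lambda> \<Longrightarrow> \<alpha> \<noteq> \<beta> \<Longrightarrow> finite (A \<alpha> \<inter> A \<beta>)"
    and null: "\<And>(f :: 'a \<Rightarrow>\<^sub>C real) \<epsilon>. \<epsilon> > 0 \<Longrightarrow> finite {\<alpha> \<in> \<Lambda>. \<epsilon> \<le> \<bar>f (a \<alpha>) - f (b \<alpha>)\<bar>}"
    and triv: "\<not> nontrivial_twisted_sum_c0_CK TYPE('a)"
  shows "\<exists>(S :: nat \<Rightarrow> ('a \<Rightarrow>\<^sub>C real) \<Rightarrow> real) C. (\<forall>p. linear (S p) \<and> (\<forall>f. \<bar>S p f\<bar> \<le> C * norm f)) \<and>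
    (\<forall>\<alpha>\<in>\<Lambda>. \<forall>f. \<forall>\<epsilon>>0. finite {p \<in> A \<alpha>. \<epsilon> \<le> \<bar>S p f - (apply_bcontfun f (a \<alpha>) - apply_bcontfun f (b \<alpha>))\<bar>})"
proof -
  let ?Z = "ad_pullback \<Lambda> A a b" and ?j = "\<lambda>y :: nat \<Rightarrow>\<^sub>C real. (y, 0 :: 'a \<Rightarrow>\<^sub>C real)"
  have "complemented_in ?Z norm (?j ` c0)"
    using triv twisted_sum_ad_pullback[of \<Lambda> A a b, OF ad null]
    unfolding nontrivial_twisted_sum_c0_CK_def trivial_twisted_sum_def by blast
  then obtain W where W: "W \<subseteq> ?Z" "subspace W" "closed_in_norm ?Z norm W" "?j ` c0 \<inter> W = {0}"
    and dec: "\<forall>z\<in>?Z. \<exists>v\<in>?j ` c0. \<exists>w\<in>W. z = v + w"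
    unfolding complemented_in_def by blast
  have "\<exists>y. (y, f) \<in> W" for f
  proof -
    obtain y where "(y, f) \<in> ?Z"
      using ad_pullback_surj[of \<Lambda> A f a b, OF ad null] .
    then obtain v w where "w \<in> W" "(y, f) = (v, 0) + w"
      using dec by blast
    then show ?thesis by (cases w) auto
  qed
  then obtain L where L: "\<And>f. (L f, f) \<in> W" by metis
  \<comment> \<open>Two points of \<open>W\<close> over the same \<open>f\<close> differ by an
    element of \<open>c0\<close> that lies in \<open>W\<close>, hence by zero.\<close>
  have uniq: "y = L f" if "(y, f) \<in> W" for y f
  proof -
    have diff: "(y - L f, 0) \<in> W"
      using subspace_diff[OF W(2) that L[of f]] by simp
    then have "(y - L f, 0) \<in> ?j ` c0"
      using W(1) by (auto simp: c0_iff_ad_pullback[of _ \<Lambda> A a b])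
    with diff W(4) have "(y - L f, 0 :: 'a \<Rightarrow>\<^sub>C real) = 0" by blast
    then show ?thesis by (simp add: zero_prod_def)
  qed
  have lin: "linear L"
  proof (rule linearI)
    show "L (f + g) = L f + L g" for f g
      using subspace_add[OF W(2) L[of f] L[of g]] by (intro uniq[symmetric]) simp
    show "L (c *\<^sub>R f) = c *\<^sub>R L f" for c f
      using subspace_scale[OF W(2) L[of f]] by (intro uniq[symmetric]) simp
  qed
  have "\<exists>C. \<forall>f. norm (L f) \<le> C * norm f"
  proof (rule closed_graph_bounded[OF lin])
    fix u f y assume u: "u \<longlonglongrightarrow> f" "(\<lambda>n. L (u n)) \<longlonglongrightarrow> y"
    have lim: "(\<lambda>n. (L (u n), u n)) \<longlonglongrightarrow> (y, f)"
      by (intro tendsto_Pair u)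
    have "(y, f) \<in> ?Z"
      by (rule closed_sequentially[OF closed_ad_pullback _ lim]) (use L W(1) in blast)
    moreover have "(\<lambda>n. norm ((L (u n), u n) - (y, f))) \<longlonglongrightarrow> 0"
      by (intro tendsto_norm_zero LIM_zero lim)
    ultimately have "(y, f) \<in> W"
      using W(3) L unfolding closed_in_norm_def by (elim allE[of _ "\<lambda>n. (L (u n), u n)"]) blast
    then show "L f = y" using uniq by simp
  qed
  then obtain C where C: "\<And>f. norm (L f) \<le> C * norm f" by blast
  have "linear (\<lambda>f. L f p)" for p
    by (rule linearI) (simp_all add: linear_add[OF lin] linear_scale[OF lin])
  moreover have "\<bar>L f p\<bar> \<le> C * norm f" for f p
    using norm_bounded[of "L f" p] C[of f] by simp
  moreover have "finite {p \<in> A \<alpha>. \<epsilon> \<le> \<bar>L f p - (f (a \<alpha>) - f (b \<alpha>))\<bar>}" if "\<alpha> \<in> \<Lambda>" "\<epsilon> > 0"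
    for \<alpha> f \<epsilon>
    using L[of f] W(1) that unfolding ad_pullback_def by blast
  ultimately show ?thesis
    by (intro exI[of _ "\<lambda>p f. L f p"] exI[of _ C]) simp
qed

section \<open>Obstructions to lifting\<close>

text \<open>Zorn's lemma, with maximality phrased so that any element of \<open>X\<close> compatible
  with all other members of \<open>T\<close> is already in \<open>T\<close>.\<close>

lemma maximal_pairwise_subset:
  assumes "symp R"
  shows "\<exists>T\<subseteq>X. pairwise R T \<and> (\<forall>t\<in>X. (\<forall>s\<in>T. s \<noteq> t \<longrightarrow> R s t) \<longrightarrow> t \<in> T)"
proof -
  have "\<exists>T\<in>{T. T \<subseteq> X \<and> pairwise R T}. \<forall>T'\<in>{T. T \<subseteq> X \<and> pairwise R T}. T \<subseteq> T' \<longrightarrow> T' = T"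
  proof (rule subset_Zorn')
    fix C assume C: "subset.chain {T. T \<subseteq> X \<and> pairwise R T} C"
    have "pairwise R (\<Union>C)"
      using C by (intro pairwise_chain_Union) (auto simp: subset_chain_def chain_subset_def)
    moreover have "\<Union>C \<subseteq> X"
      using C by (auto simp: subset_chain_def)
    ultimately show "\<Union>C \<in> {T. T \<subseteq> X \<and> pairwise R T}" by blast
  qed
  then obtain T where "T \<in> {T. T \<subseteq> X \<and> pairwise R T}"
    and max: "\<forall>T'\<in>{T. T \<subseteq> X \<and> pairwise R T}. T \<subseteq> T' \<longrightarrow> T' = T" ..
  then have T: "T \<subseteq> X" "pairwise R T" by simp_all
  have "t \<in> T" if t: "t \<in> X" "\<forall>s\<in>T. s \<noteq> t \<longrightarrow> R s t" for t
  proof -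
    have "pairwise R (insert t T)"
      using T(2) t(2) sympD[OF assms] by (simp add: pairwise_insert)
    then have "insert t T \<in> {T. T \<subseteq> X \<and> pairwise R T}"
      using T(1) t(1) by simp
    then have "insert t T = T"
      using max by blast
    then show ?thesis by blast
  qed
  with T show ?thesis by (intro exI[of _ T]) simp
qed

lemma corson_viaD:
  assumes "corson_via \<phi>"
  shows "\<And>i. continuous_on UNIV (\<lambda>x. \<phi> x i)" "inj \<phi>" "\<And>x. countable {i. \<phi> x i \<noteq> 0}"
  using assms unfolding corson_via_def
  by (auto intro: continuous_on_product_then_coordinatewise)

text \<open>An increment of size \<open>\<epsilon>\<close> needs a difference in one of finitely
  many coordinates, and distinct indices use distinct coordinates.\<close>

lemma null_of_disjoint_differences:
  fixes \<phi> :: "'a::t2_space \<Rightarrow> 'i \<Rightarrow> real" and f :: "'a \<Rightarrow>\<^sub>C real"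
  assumes K: "compact (UNIV :: 'a set)" and \<phi>: "corson_via \<phi>"
    and disj: "\<And>\<alpha> \<beta> i. \<alpha> \<in> \<Lambda> \<Longrightarrow> \<beta> \<in> \<Lambda> \<Longrightarrow> \<alpha> \<noteq> \<beta> \<Longrightarrow>
      \<phi> (a \<alpha>) i \<noteq> \<phi> (b \<alpha>) i \<Longrightarrow> \<phi> (a \<beta>) i = \<phi> (b \<beta>) i"
    and e: "\<epsilon> > 0"
  shows "finite {\<alpha> \<in> \<Lambda>. \<epsilon> \<le> \<bar>f (a \<alpha>) - f (b \<alpha>)\<bar>}"
proof -
  obtain F where F: "finite F" "\<And>x y. (\<And>i. i \<in> F \<Longrightarrow> \<phi> x i = \<phi> y i) \<Longrightarrow> \<bar>f x - f y\<bar> < \<epsilon>"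
    using continuous_finitely_determined[OF K corson_viaD(1,2)[OF \<phi>] _ e, of f] by auto
  have "\<exists>i\<in>F. \<phi> (a \<alpha>) i \<noteq> \<phi> (b \<alpha>) i" if "\<epsilon> \<le> \<bar>f (a \<alpha>) - f (b \<alpha>)\<bar>" for \<alpha>
    using F(2)[of "a \<alpha>" "b \<alpha>"] that by force
  then obtain i where i: "\<And>\<alpha>. \<epsilon> \<le> \<bar>f (a \<alpha>) - f (b \<alpha>)\<bar> \<Longrightarrow> i \<alpha> \<in> F \<and> \<phi> (a \<alpha>) (i \<alpha>) \<noteq> \<phi> (b \<alpha>) (i \<alpha>)"
    by metis
  show ?thesis
  proof (rule inj_on_finite[OF _ _ F(1)])
    show "inj_on i {\<alpha> \<in> \<Lambda>. \<epsilon> \<le> \<bar>f (a \<alpha>) - f (b \<alpha>)\<bar>}"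
      using i disj by (intro inj_onI) (metis (no_types, lifting) mem_Collect_eq)
  qed (use i in auto)
qed

lemma apply_bcontfun_sum:
  fixes h :: "'n \<Rightarrow> 'a::topological_space \<Rightarrow>\<^sub>C real"
  shows "apply_bcontfun (sum h N) x = (\<Sum>n\<in>N. h n x)"
  by (induction N rule: infinite_finite_induct) auto

text \<open>The sum of the \<open>h n\<close> with the signs of \<open>S (h n)\<close> has norm at
  most one by disjointness, while \<open>S\<close> adds up all the moduli on it.\<close>

lemma card_large_on_disjoint:
  fixes S :: "('a::topological_space \<Rightarrow>\<^sub>C real) \<Rightarrow> real" and h :: "'n \<Rightarrow> 'a \<Rightarrow>\<^sub>C real"
  assumes S: "linear S" "\<And>f. \<bar>S f\<bar> \<le> C * norm f"
    and N: "finite N" and h1: "\<And>n x. n \<in> N \<Longrightarrow> \<bar>h n x\<bar> \<le> 1"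
    and disj: "\<And>n m x. n \<in> N \<Longrightarrow> m \<in> N \<Longrightarrow> n \<noteq> m \<Longrightarrow> h n x \<noteq> 0 \<Longrightarrow> h m x = 0"
    and large: "\<And>n. n \<in> N \<Longrightarrow> 1/2 < \<bar>S (h n)\<bar>"
  shows "real (card N) \<le> 2 * \<bar>C\<bar>"
proof -
  define F where "F = (\<Sum>n\<in>N. sgn (S (h n)) *\<^sub>R h n)"
  have sg: "\<bar>sgn r\<bar> \<le> 1" for r :: real by (simp add: sgn_real_def)
  have "norm (F x) \<le> 1" for x
  proof (cases "\<exists>n\<in>N. h n x \<noteq> 0")
    case True
    then obtain n where n: "n \<in> N" "h n x \<noteq> 0" by blast
    have "F x = (\<Sum>m\<in>N. sgn (S (h m)) * h m x)"
      by (simp add: F_def apply_bcontfun_sum)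
    also have "\<dots> = (\<Sum>m\<in>{n}. sgn (S (h m)) * h m x)"
      using n N disj[of n _ x] by (intro sum.mono_neutral_right) auto
    finally have "\<bar>F x\<bar> = \<bar>sgn (S (h n))\<bar> * \<bar>h n x\<bar>"
      by (simp add: abs_mult)
    also have "\<dots> \<le> 1 * 1"
      using sg h1[OF n(1)] by (intro mult_mono) auto
    finally show ?thesis by simp
  next
    case False
    then show ?thesis
      by (simp add: F_def apply_bcontfun_sum)
  qed
  then have "norm F \<le> 1"
    by (rule norm_bound)
  have "real (card N) * (1/2) \<le> (\<Sum>n\<in>N. \<bar>S (h n)\<bar>)"
    using large by (intro sum_bounded_below) (auto intro: less_imp_le)
  also have "\<dots> = S F"
    by (simp add: F_def linear_sum[OF S(1)] linear_scale[OF S(1)] abs_sgn mult.commute)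
  also have "\<dots> \<le> C * norm F"
    using S(2)[of F] by linarith
  also have "\<dots> \<le> \<bar>C\<bar> * 1"
    using \<open>norm F \<le> 1\<close> by (intro mult_mono) auto
  finally show ?thesis by simp
qed

text \<open>\<open>n \<alpha>\<close> is a colour of \<open>\<alpha>\<close>. Given a bounded lifting, \<open>B k\<close> collects the \<open>p\<close> at which its
  \<open>p\<close>-th coordinate is large on a bump function of colour \<open>k\<close>.\<close>
lemma almost_cover_of_bounded_multiplicity:
  fixes \<phi> :: "'a::t2_space \<Rightarrow> 'i \<Rightarrow> real" and n :: "'l \<Rightarrow> 'n"
  assumes K: "compact (UNIV :: 'a set)" and \<phi>: "corson_via \<phi>"
    and triv: "\<not> nontrivial_twisted_sum_c0_CK TYPE('a)"
    and ad: "\<And>\<alpha> \<beta>. \<alpha> \<in> \<Lambda> \<Longrightarrow> \<beta> \<in> \<Lambda> \<Longrightarrow> \<alpha> \<noteq> \<beta> \<Longrightarrow> finite (A \<alpha> \<inter> A \<beta>)"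
    and diff: "\<And>\<alpha> \<beta> i. \<alpha> \<in> \<Lambda> \<Longrightarrow> \<beta> \<in> \<Lambda> \<Longrightarrow> \<alpha> \<noteq> \<beta> \<Longrightarrow>
      \<phi> (a \<alpha>) i \<noteq> \<phi> (b \<alpha>) i \<Longrightarrow> \<phi> (a \<beta>) i = \<phi> (b \<beta>) i"
    and U: "\<And>\<alpha>. \<alpha> \<in> \<Lambda> \<Longrightarrow> open (U \<alpha>)" "\<And>\<alpha>. \<alpha> \<in> \<Lambda> \<Longrightarrow> a \<alpha> \<in> U \<alpha>" "\<And>\<alpha>. \<alpha> \<in> \<Lambda> \<Longrightarrow> b \<alpha> \<notin> U \<alpha>"
    and disj: "\<And>\<alpha> \<beta>. \<alpha> \<in> \<Lambda> \<Longrightarrow> \<beta> \<in> \<Lambda> \<Longrightarrow> n \<alpha> \<noteq> n \<beta> \<Longrightarrow> U \<alpha> \<inter> U \<beta> = {}"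
  shows "\<exists>(B :: 'n \<Rightarrow> nat set) m. (\<forall>p N. finite N \<and> (\<forall>k\<in>N. p \<in> B k) \<longrightarrow> card N \<le> m) \<and>
    (\<forall>\<alpha>\<in>\<Lambda>. finite (A \<alpha> - B (n \<alpha>)))"
proof -
  have null: "finite {\<alpha> \<in> \<Lambda>. \<epsilon> \<le> \<bar>f (a \<alpha>) - f (b \<alpha>)\<bar>}" if "\<epsilon> > 0" for f :: "'a \<Rightarrow>\<^sub>C real" and \<epsilon>
    by (rule null_of_disjoint_differences[OF K \<phi> _ that]) (rule diff)
  have "\<exists>(S :: nat \<Rightarrow> ('a \<Rightarrow>\<^sub>C real) \<Rightarrow> real) C. (\<forall>p. linear (S p) \<and> (\<forall>f. \<bar>S p f\<bar> \<le> C * norm f)) \<and>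
      (\<forall>\<alpha>\<in>\<Lambda>. \<forall>f. \<forall>\<epsilon>>0. finite {p \<in> A \<alpha>. \<epsilon> \<le> \<bar>S p f - (apply_bcontfun f (a \<alpha>) - apply_bcontfun f (b \<alpha>))\<bar>})"
    by (rule bounded_lifting) (fact ad null triv)+
  then obtain S :: "nat \<Rightarrow> ('a \<Rightarrow>\<^sub>C real) \<Rightarrow> real" and C
    where "\<forall>p. linear (S p) \<and> (\<forall>f. \<bar>S p f\<bar> \<le> C * norm f)"
      and "\<forall>\<alpha>\<in>\<Lambda>. \<forall>f. \<forall>\<epsilon>>0. finite {p \<in> A \<alpha>. \<epsilon> \<le> \<bar>S p f - (apply_bcontfun f (a \<alpha>) - apply_bcontfun f (b \<alpha>))\<bar>}"
    by blast
  then have S: "\<And>p. linear (S p)" "\<And>p f. \<bar>S p f\<bar> \<le> C * norm f"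
    and lim: "\<And>\<alpha> f \<epsilon>. \<alpha> \<in> \<Lambda> \<Longrightarrow> \<epsilon> > 0 \<Longrightarrow> finite {p \<in> A \<alpha>. \<epsilon> \<le> \<bar>S p f - (f (a \<alpha>) - f (b \<alpha>))\<bar>}"
    by simp_all
  have "\<exists>f :: 'a \<Rightarrow>\<^sub>C real. f (a \<alpha>) = 1 \<and> (\<forall>y. y \<notin> U \<alpha> \<longrightarrow> f y = 0) \<and> (\<forall>y. \<bar>f y\<bar> \<le> 1)" if "\<alpha> \<in> \<Lambda>" for \<alpha>
    using bump_function[OF K corson_viaD(1,2)[OF \<phi>] U(1,2)[OF that]] by metis
  then obtain f :: "'l \<Rightarrow> 'a \<Rightarrow>\<^sub>C real"
    where f: "\<And>\<alpha>. \<alpha> \<in> \<Lambda> \<Longrightarrow> f \<alpha> (a \<alpha>) = 1" "\<And>\<alpha> y. \<alpha> \<in> \<Lambda> \<Longrightarrow> y \<notin> U \<alpha> \<Longrightarrow> f \<alpha> y = 0"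
      "\<And>\<alpha> y. \<alpha> \<in> \<Lambda> \<Longrightarrow> \<bar>f \<alpha> y\<bar> \<le> 1"
    by metis
  define B where "B k = {p. \<exists>\<alpha>\<in>\<Lambda>. n \<alpha> = k \<and> 1/2 < \<bar>S p (f \<alpha>)\<bar>}" for k
  have "card N \<le> nat \<lceil>2 * \<bar>C\<bar>\<rceil>" if N: "finite N" "\<forall>k\<in>N. p \<in> B k" for p N
  proof -
    \<comment> \<open>One bump per colour: different colours have disjoint open sets, hence bumps
      that are never both nonzero.\<close>
    from N(2) obtain g where g: "\<And>k. k \<in> N \<Longrightarrow> g k \<in> \<Lambda> \<and> n (g k) = k \<and> 1/2 < \<bar>S p (f (g k))\<bar>"
      unfolding B_def mem_Collect_eq by metis
    have "real (card N) \<le> 2 * \<bar>C\<bar>"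
    proof (rule card_large_on_disjoint[OF S(1) S(2) N(1), of "\<lambda>k. f (g k)" p])
      fix k l x assume kl: "k \<in> N" "l \<in> N" "k \<noteq> l" "f (g k) x \<noteq> 0"
      then have "U (g k) \<inter> U (g l) = {}"
        using g by (intro disj) auto
      moreover have "x \<in> U (g k)"
        using kl g f(2) by blast
      ultimately show "f (g l) x = 0"
        using kl g f(2) by blast
    qed (use g f(3) in auto)
    then show ?thesis by linarith
  qed
  moreover have "finite (A \<alpha> - B (n \<alpha>))" if \<alpha>: "\<alpha> \<in> \<Lambda>" for \<alpha>
  proof -
    have "finite {p \<in> A \<alpha>. 1/2 \<le> \<bar>S p (f \<alpha>) - (f \<alpha> (a \<alpha>) - f \<alpha> (b \<alpha>))\<bar>}"
      by (rule lim[OF \<alpha>]) simp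
    moreover have "f \<alpha> (a \<alpha>) - f \<alpha> (b \<alpha>) = 1"
      using f(1,2) \<alpha> U(3) by simp
    moreover have "1/2 \<le> \<bar>S p (f \<alpha>) - 1\<bar>" if "p \<notin> B (n \<alpha>)" for p
    proof -
      have "\<not> 1/2 < \<bar>S p (f \<alpha>)\<bar>"
        using that \<alpha> unfolding B_def by blast
      then show ?thesis by linarith
    qed
    ultimately show ?thesis
      by (auto elim!: rev_finite_subset)
  qed
  ultimately show ?thesis
    by (intro exI[of _ B] exI[of _ "nat \<lceil>2 * \<bar>C\<bar>\<rceil>"]) blast
qed

text \<open>Branches are indexed by sets of naturals, so an index set larger than the continuum is
  first cut down to one that still is uncountable.\<close>

lemma uncountable_subset_into_nat_set:
  assumes "uncountable T"
  obtains T' and e :: "'b \<Rightarrow> nat set" where "T' \<subseteq> T" "uncountable T'" "inj_on e T'"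
proof (cases "|T| \<le>o |UNIV :: nat set set|")
  case True
  then show ?thesis
    using that assms unfolding card_of_ordLeq[symmetric] by blast
next
  case False
  then have "|UNIV :: nat set set| \<le>o |T|"
    using ordLess_or_ordLeq[OF card_of_Well_order card_of_Well_order] ordLess_imp_ordLeq by blast
  then obtain g :: "nat set \<Rightarrow> 'b" where g: "inj g" "range g \<subseteq> T"
    unfolding card_of_ordLeq[symmetric] by blast
  have "|UNIV :: real set| \<le>o |range g|"
    using card_real_le_nat_set card_of_ordLeqI[OF g(1)] ordLeq_transitive by blast
  then have "uncountable (range g)"
    using countable_below_continuum not_below_continuum_iff by blast
  then show ?thesis
    using that[of "range g" "inv g"] g by (simp add: inj_on_inv_into)
qed

definition coord_supp :: "('a \<Rightarrow> 'i \<Rightarrow> real) \<Rightarrow> 'a set \<Rightarrow> 'i set" where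
  "coord_supp \<phi> U = {i. \<exists>x\<in>U. \<phi> x i \<noteq> 0}"

text \<open>The colours are the open sets themselves. Bounded multiplicity leaves only countably
  many colours with \<open>B k\<close> nonempty, yet every colour in use has an infinite branch
  almost inside its \<open>B k\<close>.\<close>

lemma nontrivial_of_uncountable_disjoint_open:
  fixes \<phi> :: "'a::t2_space \<Rightarrow> 'i \<Rightarrow> real" and \<V> :: "'a set set"
  assumes K: "compact (UNIV :: 'a set)" and \<phi>: "corson_via \<phi>"
    and V: "uncountable \<V>" "disjoint \<V>" "\<And>V. V \<in> \<V> \<Longrightarrow> open V" "\<And>V. V \<in> \<V> \<Longrightarrow> V \<noteq> {}"
  shows "nontrivial_twisted_sum_c0_CK TYPE('a)"
proof (rule ccontr)
  assume triv: "\<not> nontrivial_twisted_sum_c0_CK TYPE('a)"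
  define P where "P = (\<lambda>(V :: 'a set, a, b). {i. \<phi> a i \<noteq> \<phi> b i})"
  define X where "X = {(V :: 'a set, a, b). V \<in> \<V> \<and> a \<in> V \<and> b \<notin> V}"
  obtain T where T: "T \<subseteq> X" "pairwise (\<lambda>s t. fst s \<noteq> fst t \<and> disjnt (P s) (P t)) T"
    and max: "\<forall>t\<in>X. (\<forall>s\<in>T. s \<noteq> t \<longrightarrow> fst s \<noteq> fst t \<and> disjnt (P s) (P t)) \<longrightarrow> t \<in> T"
    using maximal_pairwise_subset[of "\<lambda>s t. fst s \<noteq> fst t \<and> disjnt (P s) (P t)" X]
    by (auto simp: symp_def disjnt_sym)
  have ctbP: "countable (P s)" for s
  proof -
    obtain V a b where s: "s = (V, a, b)" by (cases s)
    have "P s \<subseteq> {i. \<phi> a i \<noteq> 0} \<union> {i. \<phi> b i \<noteq> 0}"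
      by (auto simp: P_def s)
    then show ?thesis
      using corson_viaD(3)[OF \<phi>] countable_subset countable_Un by metis
  qed
  \<comment> \<open>From a countable maximal family, erasing the coordinates outside a countable
    \<open>J\<close> produces one more admissible triple.\<close>
  have "uncountable T"
  proof
    assume "countable T"
    then have "countable (\<Union>s\<in>T. P s)" using ctbP by blast
    then have "|\<Union>s\<in>T. P s| \<le>o |UNIV :: nat set|"
      by (rule card_of_countable_ordLeq_infinite) simp
    then obtain J D where J: "(\<Union>s\<in>T. P s) \<subseteq> J" and D: "|J| \<le>o |UNIV :: nat set|" "|D| \<le>o |UNIV :: nat set|"
      and retr: "\<forall>x. \<exists>y\<in>closure D. \<forall>i. \<phi> y i = (if i \<in> J then \<phi> x i else 0)"
      by (rule retraction_coordinates[OF K corson_viaD(1,3)[OF \<phi>] infinite_UNIV_nat])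
    have "countable D"
      using D(2) unfolding card_of_ordLeq[symmetric] by (auto intro: countableI)
    have "countable {V \<in> \<V>. V \<inter> D \<noteq> {}}"
    proof -
      have "\<forall>V\<in>{V \<in> \<V>. V \<inter> D \<noteq> {}}. \<exists>d. d \<in> V \<inter> D" by blast
      then obtain d where d: "\<And>V. V \<in> \<V> \<Longrightarrow> V \<inter> D \<noteq> {} \<Longrightarrow> d V \<in> V \<inter> D"
        unfolding bchoice_iff by blast
      have "inj_on d {V \<in> \<V>. V \<inter> D \<noteq> {}}"
      proof (rule inj_onI)
        fix V W assume VW: "V \<in> {V \<in> \<V>. V \<inter> D \<noteq> {}}" "W \<in> {V \<in> \<V>. V \<inter> D \<noteq> {}}" "d V = d W"
        then have "d V \<in> V" "d V \<in> W"
          using d[of V] d[of W] by auto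
        then show "V = W"
          using V(2) VW(1,2) by (auto simp: pairwise_def disjnt_def)
      qed
      moreover have "d ` {V \<in> \<V>. V \<inter> D \<noteq> {}} \<subseteq> D"
        using d by blast
      ultimately show ?thesis
        using \<open>countable D\<close> countable_image_inj_on countable_subset by metis
    qed
    then have "countable ({V \<in> \<V>. V \<inter> D \<noteq> {}} \<union> fst ` T)"
      using \<open>countable T\<close> by simp
    then have "\<not> \<V> \<subseteq> {V \<in> \<V>. V \<inter> D \<noteq> {}} \<union> fst ` T"
      using V(1) by (metis countable_subset)
    then obtain W where W: "W \<in> \<V>" "W \<inter> D = {}" "W \<notin> fst ` T"
      by (auto simp: subset_iff)
    \<comment> \<open>The retract \<open>b\<close> of a point of \<open>W\<close> lies in this
      closure, hence outside \<open>W\<close>.\<close>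
    have "W \<inter> closure D = {}"
      using W(2) V(3)[OF W(1)] by (simp add: open_Int_closure_eq_empty)
    obtain a where a: "a \<in> W" using V(4)[OF W(1)] by blast
    obtain b where b: "b \<in> closure D" "\<And>i. \<phi> b i = (if i \<in> J then \<phi> a i else 0)"
      using retr by metis
    have "P (W, a, b) \<inter> J = {}"
      using b(2) by (auto simp: P_def)
    then have "disjnt (P s) (P (W, a, b))" if "s \<in> T" for s
      using J that by (auto simp: disjnt_def)
    moreover have "(W, a, b) \<in> X"
      using W a b(1) \<open>W \<inter> closure D = {}\<close> by (auto simp: X_def)
    moreover have "fst s \<noteq> fst (W, a, b)" if "s \<in> T" for s
      using W(3) that by auto
    ultimately have "(W, a, b) \<in> T"
      using max by blast
    with W(3) show False
      by (metis fst_conv image_eqI)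
  qed
  then obtain T' and e :: "'a set \<times> 'a \<times> 'a \<Rightarrow> nat set"
    where T': "T' \<subseteq> T" "uncountable T'" "inj_on e T'"
    using uncountable_subset_into_nat_set by metis
  have pw: "fst s \<noteq> fst t" "disjnt (P s) (P t)" if "s \<in> T'" "t \<in> T'" "s \<noteq> t" for s t
    using T(2) T'(1) that by (auto simp: pairwise_def)
  have X: "fst s \<in> \<V>" "fst (snd s) \<in> fst s" "snd (snd s) \<notin> fst s" if "s \<in> T'" for s
    using that T(1) T'(1) by (auto simp: X_def)
  have "\<exists>(B :: _ \<Rightarrow> nat set) m. (\<forall>p N. finite N \<and> (\<forall>k\<in>N. p \<in> B k) \<longrightarrow> card N \<le> m) \<and>
      (\<forall>s\<in>T'. finite (branch (e s) - B (fst s)))"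
  proof (rule almost_cover_of_bounded_multiplicity[OF K \<phi> triv, where a = "\<lambda>s. fst (snd s)" and b = "\<lambda>s. snd (snd s)" and U = fst])
    show "finite (branch (e s) \<inter> branch (e t))" if "s \<in> T'" "t \<in> T'" "s \<noteq> t" for s t
      using that T'(3) by (intro finite_branch_Int) (auto dest: inj_onD)
    show "\<phi> (fst (snd t)) i = \<phi> (snd (snd t)) i"
      if "s \<in> T'" "t \<in> T'" "s \<noteq> t" "\<phi> (fst (snd s)) i \<noteq> \<phi> (snd (snd s)) i" for s t i
      using pw(2)[OF that(1-3)] that(4) by (auto simp: P_def disjnt_iff split: prod.splits)
    show "fst s \<inter> fst t = {}" if "s \<in> T'" "t \<in> T'" "fst s \<noteq> fst t" for s t
      using X(1) that V(2) by (auto simp: pairwise_def disjnt_def)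
  qed (use X V(3) in auto)
  then obtain B :: "'a set \<Rightarrow> nat set" and m
    where mult: "\<forall>p N. finite N \<and> (\<forall>k\<in>N. p \<in> B k) \<longrightarrow> card N \<le> m"
      and fin: "\<forall>s\<in>T'. finite (branch (e s) - B (fst s))"
    by blast
  have "finite {k. p \<in> B k}" for p
  proof (rule ccontr)
    assume "infinite {k. p \<in> B k}"
    then obtain N where "N \<subseteq> {k. p \<in> B k}" "finite N" "card N = Suc m"
      using infinite_arbitrarily_large by blast
    then show False
      using mult[rule_format, of N p] by auto
  qed
  then have "countable (\<Union>p. {k. p \<in> B k})"
    by (intro countable_UN) (auto intro: countable_finite)
  moreover have "fst ` T' \<subseteq> (\<Union>p. {k. p \<in> B k})"
  proof
    fix k assume "k \<in> fst ` T'"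
    then obtain s where s: "s \<in> T'" "k = fst s" by blast
    have "\<not> branch (e s) \<subseteq> branch (e s) - B k"
      using fin[rule_format, OF s(1)] infinite_branch finite_subset s(2) by metis
    then show "k \<in> (\<Union>p. {k. p \<in> B k})" by blast
  qed
  moreover have "inj_on fst T'"
    by (rule inj_onI, rule ccontr) (use pw(1) in blast)
  ultimately have "countable T'"
    using countable_image_inj_on countable_subset by metis
  with T'(2) show False by blast
qed

section \<open>Diagonal choice of the almost disjoint family\<close>

text \<open>Choosing the sets \<open>A \<alpha>\<close> is a diagonalization: \<open>\<alpha>\<close> runs over all sequences \<open>B\<close> of sets of
  integers, and \<open>A \<alpha>\<close> is an infinite set disjoint from one term of \<open>\<alpha>\<close>, whose number is the
  colour of \<open>\<alpha>\<close>.\<close>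
lemma nontrivial_of_large_open_sequence:
  fixes \<phi> :: "'a::t2_space \<Rightarrow> 'i \<Rightarrow> real" and U :: "nat \<Rightarrow> 'a set"
  assumes K: "compact (UNIV :: 'a set)" and \<phi>: "corson_via \<phi>"
    and U: "\<And>n. open (U n)" "\<And>n m. n \<noteq> m \<Longrightarrow> U n \<inter> U m = {}"
    and F: "\<And>n. finite (F n)" "\<And>n x y. x \<in> U n \<Longrightarrow> (\<And>i. i \<in> F n \<Longrightarrow> \<phi> y i = \<phi> x i) \<Longrightarrow> y \<in> U n"
    and large: "\<And>n. \<not> below_continuum (coord_supp \<phi> (U n))"
  shows "nontrivial_twisted_sum_c0_CK TYPE('a)"
proof (rule ccontr)
  assume triv: "\<not> nontrivial_twisted_sum_c0_CK TYPE('a)"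
  \<comment> \<open>Each index carries a pair in every \<open>U n\<close>, and the differences of
    all of them are reserved, so its colour can be chosen freely afterwards.\<close>
  define P where "P s = {i. \<exists>n. \<phi> (fst (s n)) i \<noteq> \<phi> (snd (s n)) i}" for s :: "nat \<Rightarrow> 'a \<times> 'a"
  define X where "X = {s. \<forall>n. fst (s n) \<in> U n \<and> snd (s n) \<in> U n \<and> fst (s n) \<noteq> snd (s n)}"
  obtain T where T: "T \<subseteq> X" "pairwise (\<lambda>s t. disjnt (P s) (P t)) T"
    and max: "\<forall>t\<in>X. (\<forall>s\<in>T. s \<noteq> t \<longrightarrow> disjnt (P s) (P t)) \<longrightarrow> t \<in> T"
    using maximal_pairwise_subset[of "\<lambda>s t. disjnt (P s) (P t)" X]
    by (auto simp: symp_def disjnt_sym)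
  have "\<not> below_continuum T"
  proof
    assume T_small: "below_continuum T"
    have ctbP: "countable (P s)" for s
    proof -
      have "P s \<subseteq> (\<Union>n. {i. \<phi> (fst (s n)) i \<noteq> 0} \<union> {i. \<phi> (snd (s n)) i \<noteq> 0})"
      proof
        fix i assume "i \<in> P s"
        then obtain n where "\<phi> (fst (s n)) i \<noteq> \<phi> (snd (s n)) i"
          unfolding P_def by blast
        then have "\<phi> (fst (s n)) i \<noteq> 0 \<or> \<phi> (snd (s n)) i \<noteq> 0" by auto
        then show "i \<in> (\<Union>n. {i. \<phi> (fst (s n)) i \<noteq> 0} \<union> {i. \<phi> (snd (s n)) i \<noteq> 0})" by blast
      qed
      then show ?thesis
        by (rule countable_subset) (intro countable_UN countable_Un corson_viaD(3)[OF \<phi>]; simp)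
    qed
    have "below_continuum (\<Union>s\<in>T. P s)"
      by (rule below_continuum_UN_countable[OF T_small ctbP])
    moreover have "below_continuum (\<Union>n. F n)"
      using F(1) by (intro countable_below_continuum countable_UN) (auto intro: countable_finite)
    \<comment> \<open>Including every \<open>F n\<close> in \<open>J\<close> keeps the retract of a
      point of \<open>U n\<close> inside \<open>U n\<close>.\<close>
    ultimately have "below_continuum ((\<Union>s\<in>T. P s) \<union> (\<Union>n. F n))"
      by (rule below_continuum_Un)
    then obtain M :: "real set" where M: "infinite M" "|(\<Union>s\<in>T. P s) \<union> (\<Union>n. F n)| \<le>o |M|" "below_continuum M"
      by (rule below_continuum_infinite_bound)
    obtain J D where J: "(\<Union>s\<in>T. P s) \<union> (\<Union>n. F n) \<subseteq> J" "|J| \<le>o |M|" "|D| \<le>o |M|"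
      and retr: "\<forall>x. \<exists>y\<in>closure D. \<forall>i. \<phi> y i = (if i \<in> J then \<phi> x i else 0)"
      by (rule retraction_coordinates[OF K corson_viaD(1,3)[OF \<phi>] M(1,2)])
    have "\<exists>x y. x \<in> U n \<and> y \<in> U n \<and> x \<noteq> y \<and> (\<forall>i\<in>J. \<phi> x i = \<phi> y i)" for n
    proof -
      have "\<not> coord_supp \<phi> (U n) \<subseteq> J"
        using large[of n] below_continuum_mono[OF card_of_mono1] below_continuum_mono[OF J(2) M(3)] by blast
      then obtain x i where x: "x \<in> U n" "\<phi> x i \<noteq> 0" "i \<notin> J"
        by (auto simp: coord_supp_def)
      obtain y where y: "\<And>i. \<phi> y i = (if i \<in> J then \<phi> x i else 0)"
        using retr by metis
      have "F n \<subseteq> J" using J(1) by blast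
      then have "y \<in> U n"
        by (intro F(2)[OF x(1)]) (use y in auto)
      moreover have "x \<noteq> y"
        using y[of i] x by auto
      ultimately show ?thesis
        using x(1) y by (intro exI[of _ x] exI[of _ y]) simp
    qed
    then obtain x y where xy: "\<And>n. x n \<in> U n" "\<And>n. y n \<in> U n" "\<And>n. x n \<noteq> y n"
      "\<And>n i. i \<in> J \<Longrightarrow> \<phi> (x n) i = \<phi> (y n) i"
      by metis
    define s where "s n = (x n, y n)" for n :: nat
    have PJ: "P s \<inter> J = {}"
      using xy(4) by (auto simp: P_def s_def)
    have "s \<in> X" using xy by (simp add: X_def s_def)
    moreover have "disjnt (P t) (P s)" if "t \<in> T" for t
      using that J(1) PJ by (auto simp: disjnt_def)
    ultimately have "s \<in> T" using max by blast
    \<comment> \<open>The new sequence avoids \<open>J\<close> in its differences, so membership in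
      \<open>T\<close> would leave it with no differences at all.\<close>
    then have "P s \<subseteq> J" using J(1) by blast
    with PJ have "P s = {}" by blast
    then have "\<phi> (x 0) = \<phi> (y 0)"
      by (auto simp: P_def s_def)
    then show False
      using xy(3)[of 0] corson_viaD(2)[OF \<phi>] by (simp add: inj_eq)
  qed
  then have "|UNIV :: (nat \<Rightarrow> nat set) set| \<le>o |T|"
    using card_nat_set_seq_le_real ordLeq_transitive not_below_continuum_iff by blast
  then obtain t :: "(nat \<Rightarrow> nat set) \<Rightarrow> nat \<Rightarrow> 'a \<times> 'a" where t: "inj t" "range t \<subseteq> T"
    unfolding card_of_ordLeq[symmetric] by blast
  obtain e :: "(nat \<Rightarrow> nat set) \<Rightarrow> nat set" where e: "inj e"
    using ordLeq_transitive[OF card_nat_set_seq_le_real card_real_le_nat_set]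
    unfolding card_of_ordLeq[symmetric] by blast
  \<comment> \<open>For an arbitrary \<open>B\<close> such a term may not exist; existence is proved
    below only for the \<open>B\<close> produced by the lifting.\<close>
  define k where "k B = (SOME k. infinite (branch (e B) - B k))" for B
  define A where "A B = branch (e B) - B (k B)" for B
  have tX: "fst (t B n) \<in> U n" "snd (t B n) \<in> U n" "fst (t B n) \<noteq> snd (t B n)" for B n
    using t(2) T(1) unfolding X_def by blast+
  have "\<exists>(B :: nat \<Rightarrow> nat set) m. (\<forall>p N. finite N \<and> (\<forall>k\<in>N. p \<in> B k) \<longrightarrow> card N \<le> m) \<and>
      (\<forall>C\<in>UNIV. finite (A C - B (k C)))"
  \<comment> \<open>Both points lie in \<open>U (k B)\<close>, so the second one is removed to make
    the bump function vanish there.\<close>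
  proof (rule almost_cover_of_bounded_multiplicity[OF K \<phi> triv, where a = "\<lambda>B. fst (t B (k B))"
        and b = "\<lambda>B. snd (t B (k B))" and U = "\<lambda>B. U (k B) - {snd (t B (k B))}"])
    show "finite (A B \<inter> A C)" if "B \<noteq> C" for B C
    proof (rule finite_subset[OF _ finite_branch_Int])
      show "e B \<noteq> e C" using e that by (simp add: inj_eq)
    qed (auto simp: A_def)
    show "\<phi> (fst (t C (k C))) i = \<phi> (snd (t C (k C))) i"
      if "B \<noteq> C" "\<phi> (fst (t B (k B))) i \<noteq> \<phi> (snd (t B (k B))) i" for B C i
    proof -
      have "t B \<noteq> t C" using t(1) that(1) by (simp add: inj_eq)
      then have "disjnt (P (t B)) (P (t C))"
        using t(2) by (intro pairwiseD[OF T(2)]) auto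
      moreover have "i \<in> P (t B)" using that(2) by (auto simp: P_def)
      ultimately have "i \<notin> P (t C)" by (auto simp: disjnt_iff)
      then show ?thesis by (simp add: P_def)
    qed
    show "open (U (k B) - {snd (t B (k B))})" for B
      by (intro open_Diff U(1)) simp
    show "(U (k B) - {snd (t B (k B))}) \<inter> (U (k C) - {snd (t C (k C))}) = {}" if "k B \<noteq> k C" for B C
      using U(2)[OF that] by blast
  qed (use tX in auto)
  then obtain B :: "nat \<Rightarrow> nat set" and m
    where mult: "\<forall>p N. finite N \<and> (\<forall>k\<in>N. p \<in> B k) \<longrightarrow> card N \<le> m"
      and fin: "\<forall>C\<in>UNIV. finite (A C - B (k C))"
    by blast
  have "\<exists>k. infinite (branch (e B) - B k)"
  proof (rule ccontr)
    assume "\<nexists>k. infinite (branch (e B) - B k)"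
    then have "finite (\<Union>k\<in>{..m}. branch (e B) - B k)" by blast
    \<comment> \<open>Otherwise some \<open>p\<close> of the branch would lie in the
      \<open>m + 1\<close> sets \<open>B 0\<close> to \<open>B m\<close>, one more than the
      multiplicity allows.\<close>
    then have "\<not> branch (e B) \<subseteq> (\<Union>k\<in>{..m}. branch (e B) - B k)"
      using infinite_branch finite_subset by blast
    then obtain p where "\<forall>k\<in>{..m}. p \<in> B k" by blast
    then have "card {..m} \<le> m"
      using mult by blast
    then show False by simp
  qed
  then have "infinite (branch (e B) - B (k B))"
    unfolding k_def by (rule someI_ex)
  moreover have "A B - B (k B) = branch (e B) - B (k B)"
    by (auto simp: A_def)
  ultimately show False
    using fin by (metis UNIV_I)
qed

text \<open>Repeated splitting, keeping \<open>f V\<close> and setting \<open>g V\<close> aside,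
  gives infinitely many disjoint open sets; each is shrunk to a box depending on finitely many
  coordinates.\<close>

lemma nontrivial_of_hereditarily_large_open:
  fixes \<phi> :: "'a::t2_space \<Rightarrow> 'i \<Rightarrow> real" and G :: "'a set"
  assumes K: "compact (UNIV :: 'a set)" and \<phi>: "corson_via \<phi>"
    and G: "open G" "G \<noteq> {}"
    and large: "\<And>V. open V \<Longrightarrow> V \<noteq> {} \<Longrightarrow> V \<subseteq> G \<Longrightarrow> \<not> below_continuum (coord_supp \<phi> V)"
  shows "nontrivial_twisted_sum_c0_CK TYPE('a)"
proof -
  define good where "good V \<longleftrightarrow> open V \<and> V \<noteq> {} \<and> V \<subseteq> G" for V
  have split: "\<exists>V' W. good V' \<and> good W \<and> V' \<subseteq> V \<and> W \<subseteq> V \<and> V' \<inter> W = {}" if "good V" for V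
  proof -
    have V: "open V" "V \<noteq> {}" "V \<subseteq> G" using that by (auto simp: good_def)
    \<comment> \<open>A single point has countable support, so a large open set can always be
      split.\<close>
    have "\<exists>x\<in>V. \<exists>y\<in>V. x \<noteq> y"
    proof (rule ccontr)
      assume *: "\<not> (\<exists>x\<in>V. \<exists>y\<in>V. x \<noteq> y)"
      obtain x where "x \<in> V" using V(2) by blast
      with * have "V = {x}" by blast
      then have "coord_supp \<phi> V = {i. \<phi> x i \<noteq> 0}"
        by (simp add: coord_supp_def)
      then show False
        using large[OF V] corson_viaD(3)[OF \<phi>] countable_below_continuum by metis
    qed
    then obtain x y where xy: "x \<in> V" "y \<in> V" "x \<noteq> y" by blast
    obtain A B where AB: "open A" "open B" "x \<in> A" "y \<in> B" "A \<inter> B = {}"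
      using hausdorff[OF xy(3)] by blast
    have "good (V \<inter> A)" "good (V \<inter> B)"
      using V AB xy by (auto simp: good_def)
    moreover have "(V \<inter> A) \<inter> (V \<inter> B) = {}"
      using AB(5) by blast
    ultimately show ?thesis
      by (metis inf_le1)
  qed
  then obtain f g where fg: "\<And>V. good V \<Longrightarrow> good (f V)" "\<And>V. good V \<Longrightarrow> good (g V)"
    "\<And>V. good V \<Longrightarrow> f V \<subseteq> V" "\<And>V. good V \<Longrightarrow> g V \<subseteq> V" "\<And>V. good V \<Longrightarrow> f V \<inter> g V = {}"
    by metis
  define V where "V n = (f ^^ n) G" for n
  have VS: "V (Suc n) = f (V n)" for n by (simp add: V_def)
  have good: "good (V n)" for n
    by (induction n) (use G fg(1) VS in \<open>auto simp: V_def good_def\<close>)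
  have anti: "V m \<subseteq> V n" if "n \<le> m" for n m
    using that
  proof (induction rule: dec_induct)
    case (step m)
    then show ?case using fg(3)[OF good[of m]] VS by blast
  qed simp
  have disj: "g (V n) \<inter> g (V m) = {}" if "n < m" for n m
  proof -
    have "g (V m) \<subseteq> f (V n)"
      using fg(4)[OF good[of m]] anti[of "Suc n" m] that VS[of n] by auto
    then show ?thesis
      using fg(5)[OF good[of n]] by blast
  qed
  have "\<exists>U F. open U \<and> U \<noteq> {} \<and> U \<subseteq> g (V n) \<and> finite F \<and>
      (\<forall>x y. x \<in> U \<longrightarrow> (\<forall>i\<in>F. \<phi> y i = \<phi> x i) \<longrightarrow> y \<in> U)" for n
  proof -
    have "good (g (V n))" using fg(2) good by blast
    then obtain x where x: "x \<in> g (V n)" and op: "open (g (V n))"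
      by (auto simp: good_def)
    obtain F \<epsilon> where F: "finite F" "\<epsilon> > 0"
      and sub: "\<And>y. (\<And>i. i \<in> F \<Longrightarrow> \<bar>\<phi> y i - \<phi> x i\<bar> < \<epsilon>) \<Longrightarrow> y \<in> g (V n)"
      using finite_coordinates_nbhd[OF K corson_viaD(1,2)[OF \<phi>] op x] by metis
    define U where "U = (\<Inter>i\<in>F. {y. \<bar>\<phi> y i - \<phi> x i\<bar> < \<epsilon>})"
    have "open U"
      unfolding U_def using F(1)
      by (intro open_INT ballI open_Collect_less continuous_intros corson_viaD(1)[OF \<phi>])
    moreover have "x \<in> U" using F(2) by (simp add: U_def)
    moreover have "U \<subseteq> g (V n)" using sub by (auto simp: U_def)
    moreover have "\<forall>x y. x \<in> U \<longrightarrow> (\<forall>i\<in>F. \<phi> y i = \<phi> x i) \<longrightarrow> y \<in> U"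
      by (simp add: U_def)
    ultimately show ?thesis using F(1) by blast
  qed
  then obtain U F where UF: "\<And>n. open (U n)" "\<And>n. U n \<noteq> {}" "\<And>n. U n \<subseteq> g (V n)" "\<And>n. finite (F n)"
    and det: "\<And>n. \<forall>x y. x \<in> U n \<longrightarrow> (\<forall>i\<in>F n. \<phi> y i = \<phi> x i) \<longrightarrow> y \<in> U n"
    by metis
  show ?thesis
  proof (rule nontrivial_of_large_open_sequence[OF K \<phi> UF(1) _ UF(4)])
    show "U n \<inter> U m = {}" if "n \<noteq> m" for n m
      using that disj[of n m] disj[of m n] UF(3)[of n] UF(3)[of m] by (cases n m rule: linorder_cases) blast+
    show "y \<in> U n" if "x \<in> U n" "\<And>i. i \<in> F n \<Longrightarrow> \<phi> y i = \<phi> x i" for n x y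
      using det[of n] that by blast
    show "\<not> below_continuum (coord_supp \<phi> (U n))" for n
    proof (rule large[OF UF(1,2)])
      show "U n \<subseteq> G"
        using UF(3)[of n] fg(2)[OF good[of n]] by (auto simp: good_def)
    qed
  qed
qed

text \<open>If no open set is hereditarily large, a maximal disjoint family of small open sets has
  dense union. Either it is uncountable, or its countably many small supports would cover all live
  coordinates, against Koenig.\<close>

lemma nontrivial_of_large_coord_supp:
  fixes \<phi> :: "'a::t2_space \<Rightarrow> 'i \<Rightarrow> real"
  assumes K: "compact (UNIV :: 'a set)" and \<phi>: "corson_via \<phi>"
    and large: "\<not> below_continuum (coord_supp \<phi> UNIV)"
  shows "nontrivial_twisted_sum_c0_CK TYPE('a)"
proof (cases "\<exists>G. open G \<and> G \<noteq> {} \<and> (\<forall>V. open V \<longrightarrow> V \<noteq> {} \<longrightarrow> V \<subseteq> G \<longrightarrow> \<not> below_continuum (coord_supp \<phi> V))")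
  case True
  then obtain G where "open G" "G \<noteq> {}" "\<forall>V. open V \<longrightarrow> V \<noteq> {} \<longrightarrow> V \<subseteq> G \<longrightarrow> \<not> below_continuum (coord_supp \<phi> V)"
    by blast
  then show ?thesis
    using nontrivial_of_hereditarily_large_open[OF K \<phi>, of G] by blast
next
  case False
  define X where "X = {V. open V \<and> V \<noteq> {} \<and> below_continuum (coord_supp \<phi> V)}"
  obtain \<V> where V: "\<V> \<subseteq> X" "pairwise disjnt \<V>"
    and max: "\<forall>V\<in>X. (\<forall>W\<in>\<V>. W \<noteq> V \<longrightarrow> disjnt W V) \<longrightarrow> V \<in> \<V>"
    using maximal_pairwise_subset[of disjnt X] by (auto simp: symp_def disjnt_sym)
  show ?thesis
  proof (cases "countable \<V>")
    case False
    then show ?thesis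
      using V by (intro nontrivial_of_uncountable_disjoint_open[OF K \<phi>, of \<V>]) (auto simp: X_def)
  next
    case True
    have meets: "\<exists>W\<in>\<V>. W \<inter> G \<noteq> {}" if G: "open G" "G \<noteq> {}" for G
    proof (rule ccontr)
      assume no: "\<not> (\<exists>W\<in>\<V>. W \<inter> G \<noteq> {})"
      obtain V where V': "open V" "V \<noteq> {}" "V \<subseteq> G" "below_continuum (coord_supp \<phi> V)"
        using False G by blast
      then have "V \<in> X" by (simp add: X_def)
      moreover have "\<forall>W\<in>\<V>. W \<noteq> V \<longrightarrow> disjnt W V"
        using no V'(3) unfolding disjnt_def by blast
      ultimately have "V \<in> \<V>" using max by blast
      with no V' show False by blast
    qed
    have "coord_supp \<phi> UNIV \<subseteq> (\<Union>V\<in>\<V>. coord_supp \<phi> V)"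
    proof
      fix i assume "i \<in> coord_supp \<phi> UNIV"
      then have "{y. \<phi> y i \<noteq> 0} \<noteq> {}" by (simp add: coord_supp_def)
      \<comment> \<open>A coordinate nonzero somewhere is nonzero on an open set, which meets the
        dense union.\<close>
      moreover have "open {y. \<phi> y i \<noteq> 0}"
        by (intro open_Collect_neq continuous_intros corson_viaD(1)[OF \<phi>])
      ultimately obtain W where "W \<in> \<V>" "W \<inter> {y. \<phi> y i \<noteq> 0} \<noteq> {}"
        using meets by blast
      then show "i \<in> (\<Union>V\<in>\<V>. coord_supp \<phi> V)"
        by (auto simp: coord_supp_def)
    qed
    moreover have "below_continuum (\<Union>V\<in>\<V>. coord_supp \<phi> V)"
    proof (cases "\<V> = {}")
      case True
      then show ?thesis by (simp add: countable_below_continuum)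
    next
      case False
      have "(\<Union>V\<in>\<V>. coord_supp \<phi> V) = (\<Union>n. coord_supp \<phi> (from_nat_into \<V> n))"
        using range_from_nat_into[OF False \<open>countable \<V>\<close>] by (metis image_image)
      moreover have "below_continuum (coord_supp \<phi> (from_nat_into \<V> n))" for n
        using from_nat_into[OF False] V(1) by (auto simp: X_def)
      ultimately show ?thesis
        using below_continuum_UN_nat[of "\<lambda>n. coord_supp \<phi> (from_nat_into \<V> n)"] by simp
    qed
    ultimately show ?thesis
      using large below_continuum_mono[OF card_of_mono1] by blast
  qed
qed

section \<open>Weight, metrizability and the number of coordinates\<close>

text \<open>Finite intersections of rational strips in the live coordinates \<open>I\<close> form a
  base, whose size is at most an infinite bound of \<open>I\<close>.\<close>

lemma weight_ge_continuum_imp_large_coord_supp: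
  fixes \<phi> :: "'a::t2_space \<Rightarrow> 'i \<Rightarrow> real"
  assumes K: "compact (UNIV :: 'a set)" and \<phi>: "corson_via \<phi>"
    and w: "weight_ge_continuum TYPE('a)"
  shows "\<not> below_continuum (coord_supp \<phi> UNIV)"
proof
  define I where "I = coord_supp \<phi> UNIV"
  assume "below_continuum (coord_supp \<phi> UNIV)"
  then have "below_continuum I" by (simp add: I_def)
  then obtain M :: "real set" where M: "infinite M" "|I| \<le>o |M|" "below_continuum M"
    by (rule below_continuum_infinite_bound)
  define box where "box ps = (\<Inter>(i, q, r)\<in>set ps. {x. of_rat q < \<phi> x i \<and> \<phi> x i < of_rat r})"
    for ps :: "('i \<times> rat \<times> rat) list"
  define \<B> where "\<B> = box ` lists (I \<times> UNIV \<times> UNIV)"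
  have "|I \<times> (UNIV :: (rat \<times> rat) set)| \<le>o |M|"
    by (rule card_of_Sigma_ordLeq_infinite[OF M(1,2)])
      (intro ballI card_of_countable_ordLeq_infinite[OF countableI_type M(1)])
  then have "|lists (I \<times> (UNIV :: (rat \<times> rat) set))| \<le>o |M|"
    by (rule card_of_lists_ordLeq_infinite[OF M(1)])
  then have "|\<B>| \<le>o |M|"
    unfolding \<B>_def using card_of_image ordLeq_transitive by (metis UNIV_Times_UNIV)
  then have small: "below_continuum \<B>"
    using M(3) by (rule below_continuum_mono)
  have "topological_basis \<B>"
  proof (rule topological_basisI)
    fix B assume "B \<in> \<B>"
    then obtain ps where B: "B = box ps" by (auto simp: \<B>_def)
    show "open B"
      unfolding B box_def case_prod_beta
      by (intro open_INT ballI open_Collect_conj open_Collect_less continuous_intros corson_viaD(1)[OF \<phi>]) simp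
  next
    fix U :: "'a set" and x assume U: "open U" "x \<in> U"
    obtain F \<epsilon> where F: "finite F" "\<epsilon> > 0"
      and sub: "\<And>y. (\<And>i. i \<in> F \<Longrightarrow> \<bar>\<phi> y i - \<phi> x i\<bar> < \<epsilon>) \<Longrightarrow> y \<in> U"
      using finite_coordinates_nbhd[OF K corson_viaD(1,2)[OF \<phi>] U] by metis
    obtain xs where xs: "set xs = F \<inter> I"
      using F(1) finite_list[of "F \<inter> I"] by auto
    have "\<exists>q. \<phi> x i - \<epsilon> < of_rat q \<and> of_rat q < \<phi> x i" for i
      using of_rat_dense[of "\<phi> x i - \<epsilon>" "\<phi> x i"] F(2) by auto
    then obtain q where q: "\<And>i. \<phi> x i - \<epsilon> < of_rat (q i)" "\<And>i. of_rat (q i) < \<phi> x i" by metis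
    have "\<exists>r. \<phi> x i < of_rat r \<and> of_rat r < \<phi> x i + \<epsilon>" for i
      using of_rat_dense[of "\<phi> x i" "\<phi> x i + \<epsilon>"] F(2) by auto
    then obtain r where r: "\<And>i. \<phi> x i < of_rat (r i)" "\<And>i. of_rat (r i) < \<phi> x i + \<epsilon>" by metis
    define ps where "ps = map (\<lambda>i. (i, q i, r i)) xs"
    have "ps \<in> lists (I \<times> UNIV \<times> UNIV)"
      using xs by (auto simp: ps_def in_lists_conv_set)
    then have "box ps \<in> \<B>" by (simp add: \<B>_def)
    moreover have "x \<in> box ps"
      using q(2) r(1) by (auto simp: box_def ps_def)
    moreover have "box ps \<subseteq> U"
    proof
      fix y assume y: "y \<in> box ps"
      show "y \<in> U"
      proof (rule sub)
        fix i assume i: "i \<in> F"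
        show "\<bar>\<phi> y i - \<phi> x i\<bar> < \<epsilon>"
        proof (cases "i \<in> I")
          case True
          then have "of_rat (q i) < \<phi> y i \<and> \<phi> y i < of_rat (r i)"
            using y xs i by (auto simp: box_def ps_def)
          then show ?thesis
            using q(1)[of i] r(2)[of i] by linarith
        next
          \<comment> \<open>A coordinate outside \<open>I\<close> vanishes at every point and
            imposes no restriction.\<close>
          case False
          then show ?thesis
            using F(2) by (simp add: I_def coord_supp_def)
        qed
      qed
    qed
    ultimately show "\<exists>B\<in>\<B>. x \<in> B \<and> B \<subseteq> U" by blast
  qed
  then obtain f :: "real \<Rightarrow> 'a set" where "inj f" "range f \<subseteq> \<B>"
    using w unfolding weight_ge_continuum_def by blast
  then have "|UNIV :: real set| \<le>o |\<B>|"
    unfolding card_of_ordLeq[symmetric] by blast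
  with small show False
    using not_below_continuum_iff by blast
qed

text \<open>Restricting to the live coordinates is still injective, so compactness embeds the space
  in a countable product of real lines.\<close>

lemma metrizable_of_countable_coord_supp:
  fixes \<phi> :: "'a::t2_space \<Rightarrow> 'i \<Rightarrow> real"
  assumes K: "compact (UNIV :: 'a set)" and \<phi>: "corson_via \<phi>"
    and ctb: "countable (coord_supp \<phi> UNIV)"
  shows "metrizable_space (euclidean :: 'a topology)"
proof -
  define I where "I = coord_supp \<phi> UNIV"
  define Y where "Y = product_topology (\<lambda>_. euclideanreal) I"
  define e where "e x = restrict (\<phi> x) I" for x
  have cont: "continuous_map (euclidean :: 'a topology) Y e"
    unfolding Y_def continuous_map_componentwise
    using corson_viaD(1)[OF \<phi>] by (auto simp: e_def)
  have "Hausdorff_space Y"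
    unfolding Y_def by (simp add: Hausdorff_space_product_topology)
  then have "closed_map euclidean Y e"
    using K by (intro continuous_imp_closed_map[OF cont]) (simp_all add: compact_space_def)
  moreover have "inj e"
  proof (rule injI)
    fix x y assume "e x = e y"
    have "\<phi> x i = \<phi> y i" for i
    proof (cases "i \<in> I")
      case True
      then show ?thesis using fun_cong[OF \<open>e x = e y\<close>, of i] by (simp add: e_def)
    qed (simp add: I_def coord_supp_def)
    then show "x = y"
      using corson_viaD(2)[OF \<phi>] by (auto dest: injD)
  qed
  ultimately have "embedding_map euclidean Y e"
    using cont by (intro injective_closed_imp_embedding_map) simp_all
  then have "(euclidean :: 'a topology) homeomorphic_space subtopology Y (e ` topspace euclidean)"
    by (rule embedding_map_imp_homeomorphic_space)
  moreover have "metrizable_space Y"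
    unfolding Y_def metrizable_space_product_topology
    using ctb by (auto simp: metrizable_space_euclidean I_def intro: countable_subset)
  ultimately show ?thesis
    using homeomorphic_metrizable_space metrizable_space_subtopology by blast
qed

text \<open>A smaller set would inject into the reals with uncountable image, and \<open>CH\<close>
  gives that image the full size of the continuum.\<close>

lemma CH_imp_not_below_continuum:
  assumes CH "uncountable S"
  shows "\<not> below_continuum S"
proof
  assume small: "below_continuum S"
  obtain h :: "'a \<Rightarrow> real" where h: "inj_on h S"
    using ordLess_imp_ordLeq[OF small] unfolding card_of_ordLeq[symmetric] by blast
  then have "uncountable (h ` S)"
    using assms(2) countable_image_inj_on by metis
  then obtain f where "bij_betw f (h ` S) (UNIV :: real set)"
    using assms(1) unfolding CH_def by blast
  then have "|UNIV :: real set| \<le>o |h ` S|"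
    using card_of_ordIsoI ordIso_iff_ordLeq by blast
  then have "|UNIV :: real set| \<le>o |S|"
    using card_of_image ordLeq_transitive by blast
  with small show False
    using not_below_continuum_iff by blast
qed

theorem theorem3p2:
  fixes \<phi> :: "'a::t2_space \<Rightarrow> ('i \<Rightarrow> real)"
  assumes "compact (UNIV :: 'a set)"
    and "corson_via \<phi>"
  shows "(weight_ge_continuum TYPE('a) \<longrightarrow> nontrivial_twisted_sum_c0_CK TYPE('a)) \<and>
         (CH \<and> \<not> metrizable_space (euclidean :: 'a topology) \<longrightarrow> nontrivial_twisted_sum_c0_CK TYPE('a))"
proof (intro conjI impI)
  assume "weight_ge_continuum TYPE('a)"
  then show "nontrivial_twisted_sum_c0_CK TYPE('a)"
    by (intro nontrivial_of_large_coord_supp[OF assms]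
        weight_ge_continuum_imp_large_coord_supp[OF assms])
next
  assume *: "CH \<and> \<not> metrizable_space (euclidean :: 'a topology)"
  then have "uncountable (coord_supp \<phi> UNIV)"
    using metrizable_of_countable_coord_supp[OF assms] by blast
  then show "nontrivial_twisted_sum_c0_CK TYPE('a)"
    using * by (intro nontrivial_of_large_coord_supp[OF assms] CH_imp_not_below_continuum) simp_all
qed

end
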